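(* Let $v\in\mathbb{R}^p$ with $\|v\|=\sqrt{p}$, and set $$\omega(v):=\max\Big\{0\leq s\leq p:\ \max_{S\subset[p],\,|S|\leq s}\|v_S\|^2\leq\frac p4\Big\}.$$ Suppose $1\leq s\leq\omega(v)$ and $\gamma\in[0,1]$. If $\omega(v)\geq\sqrt{p}$, then $$\varepsilon^*(p,s,\gamma,v)^2\asymp\begin{cases}(1-\gamma)s\log\left(1+\frac{p}{s^2}\right)&\text{if }s\leq\sqrt{p},\\(1-\gamma)\sqrt{p}&\text{if }\sqrt{p}<s\leq\omega(v).\end{cases}$$ If $\omega(v)<\sqrt{p}$, then $$\varepsilon^*(p,s,\gamma,v)^2\asymp(1-\gamma)s\log\left(1+\frac{p}{s^2}\right).$$
   Context: Notation: $[p]=\{1,\dots,p\}$; $s$ is an integer; $\|\cdot\|$ is the Euclidean norm; $\|\theta\|_0$ is the number of nonzero coordinates; $v_S$ is the vector that agrees with $v$ on $S$ and vanishes off $S$. For a known $v\in\mathbb{R}^p$ with $\|v\|=\sqrt p$, $P_{\theta,\gamma,v}$ denotes the distribution $N(\theta,(1-\gamma)I_p+\gamma vv^\intercal)$ of the observation $X$. For $\varepsilon>0$, $\Theta(p,s,\varepsilon)=\{\theta\in\mathbb{R}^p:\|\theta\|\geq\varepsilon,\ \|\theta\|_0\leq s\}$. The minimax testing risk for $H_0:\theta=0$ against $H_1:\theta\in\Theta(p,s,\varepsilon)$ is $$\mathcal{R}(\varepsilon,v)=\inf_{\varphi}\Big\{P_{0,\gamma,v}\{\varphi=1\}+\sup_{\theta\in\Theta(p,s,\varepsilon)}P_{\theta,\gamma,v}\{\varphi=0\}\Big\},$$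 the infimum being over all measurable $\varphi:\mathbb{R}^p\to\{0,1\}$ (which may depend on $v$). Definition: $\varepsilon^*=\varepsilon^*(p,s,\gamma,v)$ is the minimax separation rate if (i) for every $\eta\in(0,1)$ there is $C_\eta>0$ depending only on $\eta$ such that $C>C_\eta$ implies $\mathcal{R}(C\varepsilon^*,v)\leq\eta$; and (ii) for every $\eta\in(0,1)$ there is $c_\eta>0$ depending only on $\eta$ such that $0<c<c_\eta$ implies $\mathcal{R}(c\varepsilon^*,v)\geq1-\eta$. The constants do not depend on $(p,s,\gamma,v)$. The rate is unique only up to multiplication by universal constants, and $a\asymp b$ means equality up to universal positive multiplicative constants; thus $(\varepsilon^* )^2\asymp\psi^2$ means that $\psi$ satisfies (i) and (ii) in place of $\varepsilon^*$. Convention for a degenerate rate: that the rate equals $0$ (here when $\gamma=1$) means $\mathcal{R}(\varepsilon,v)=0$ for every $\varepsilon>0$. *)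

theory Defs
  imports "HOL-Probability.Probability"
begin

text \<open>
  The dimension \<open>p\<close> has to range inside the statement (the constants of a separation rate are
  uniform in \<open>p\<close>), so \<open>\<real>\<^sup>p\<close> is the space of the measure \<open>Rp p\<close>, that is, the functions
  \<open>nat \<Rightarrow> real\<close> that are \<open>undefined\<close> off \<open>{1..p}\<close>, with its Borel sets. The Euclidean norm
  of \<open>x\<close> is \<open>L2_set x {1..p}\<close>. A \<open>p \<times> p\<close> matrix is a function
  \<open>nat \<Rightarrow> nat \<Rightarrow> real\<close> of which only the entries over \<open>{1..p}\<close> matter.
\<close>

definition Rp :: "nat \<Rightarrow> (nat \<Rightarrow> real) measure" where
  "Rp p = PiM {1..p} (\<lambda>_. borel)"

definition restr :: "(nat \<Rightarrow> real) \<Rightarrow> nat set \<Rightarrow> nat \<Rightarrow> real" where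
  "restr v S = (\<lambda>i. if i \<in> S then v i else 0)"

definition norm0 :: "nat \<Rightarrow> (nat \<Rightarrow> real) \<Rightarrow> nat" where
  "norm0 p \<theta> = card {i \<in> {1..p}. \<theta> i \<noteq> 0}"

subsection \<open>Multivariate normal distributions, possibly degenerate\<close>

definition psd :: "nat \<Rightarrow> (nat \<Rightarrow> nat \<Rightarrow> real) \<Rightarrow> bool" where
  "psd p A \<longleftrightarrow> (\<forall>i\<in>{1..p}. \<forall>j\<in>{1..p}. A i j = A j i) \<and>
     (\<forall>x. 0 \<le> (\<Sum>i=1..p. \<Sum>j=1..p. x i * A i j * x j))"

definition psd_root :: "nat \<Rightarrow> (nat \<Rightarrow> nat \<Rightarrow> real) \<Rightarrow> (nat \<Rightarrow> nat \<Rightarrow> real) \<Rightarrow> bool" where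
  "psd_root p \<Sigma> A \<longleftrightarrow> psd p A \<and>
     (\<forall>i\<in>{1..p}. \<forall>j\<in>{1..p}. (\<Sum>k=1..p. A i k * A k j) = \<Sigma> i j)"

text \<open>
  The entries over \<open>{1..p}\<close> of a positive semidefinite root are unique, see
  \<open>psd_root_unique\<close> below; the choice operator only fixes the irrelevant entries.
  For the covariances used here a root exists, see \<open>psd_root_spiked_cov\<close>.
\<close>

definition mat_sqrt :: "nat \<Rightarrow> (nat \<Rightarrow> nat \<Rightarrow> real) \<Rightarrow> nat \<Rightarrow> nat \<Rightarrow> real" where
  "mat_sqrt p \<Sigma> = (SOME A. psd_root p \<Sigma> A)"

text \<open>
  \<open>N(\<mu>, \<Sigma>)\<close> is the law of \<open>\<mu> + \<Sigma>\<^sup>1\<^sup>/\<^sup>2 Z\<close> with \<open>Z\<close> standard normal. There is no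
  density in general: \<open>\<Sigma>\<close> may be singular.
\<close>

definition mvn :: "nat \<Rightarrow> (nat \<Rightarrow> real) \<Rightarrow> (nat \<Rightarrow> nat \<Rightarrow> real) \<Rightarrow> (nat \<Rightarrow> real) measure" where
  "mvn p \<mu> \<Sigma> =
     distr (PiM {1..p} (\<lambda>_. density lborel std_normal_density)) (Rp p)
       (\<lambda>z. \<lambda>i\<in>{1..p}. \<mu> i + (\<Sum>j=1..p. mat_sqrt p \<Sigma> i j * z j))"

definition spiked_cov :: "real \<Rightarrow> (nat \<Rightarrow> real) \<Rightarrow> nat \<Rightarrow> nat \<Rightarrow> real" where
  "spiked_cov \<gamma> v = (\<lambda>i j. (1 - \<gamma>) * (if i = j then 1 else 0) + \<gamma> * (v i * v j))"

definition obs_law :: "nat \<Rightarrow> (nat \<Rightarrow> real) \<Rightarrow> real \<Rightarrow> (nat \<Rightarrow> real) \<Rightarrow> (nat \<Rightarrow> real) measure" where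
  "obs_law p \<theta> \<gamma> v = mvn p \<theta> (spiked_cov \<gamma> v)"

lemma psd_null:
  assumes A: "psd p A" and y: "(\<Sum>i=1..p. \<Sum>j=1..p. y i * A i j * y j) = 0" and k: "k \<in> {1..p}"
  shows "(\<Sum>j=1..p. A k j * y j) = 0"
proof -
  define w where "w i = (\<Sum>j=1..p. A i j * y j)" for i
  define W where "W = (\<Sum>i=1..p. w i * w i)"
  define Q where "Q = (\<Sum>i=1..p. \<Sum>j=1..p. w i * A i j * w j)"
  have 1: "(\<Sum>i=1..p. \<Sum>j=1..p. w i * A i j * y j) = W"
    by (simp add: W_def w_def sum_distrib_left mult.assoc)
  have "(\<Sum>i=1..p. \<Sum>j=1..p. y i * A i j * w j) = (\<Sum>j=1..p. \<Sum>i=1..p. w j * A j i * y i)"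
    using A by (subst sum.swap) (auto simp: psd_def intro!: sum.cong)
  then have 2: "(\<Sum>i=1..p. \<Sum>j=1..p. y i * A i j * w j) = W"
    using 1 by simp
  have ineq: "0 \<le> t\<^sup>2 * Q - 2 * t * W" for t
  proof -
    have "0 \<le> (\<Sum>i=1..p. \<Sum>j=1..p. (y i - t * w i) * A i j * (y j - t * w j))"
      using A unfolding psd_def by (elim conjE allE) assumption
    also have "\<dots> = (\<Sum>i=1..p. \<Sum>j=1..p. y i * A i j * y j - t * (y i * A i j * w j)
        - t * (w i * A i j * y j) + t\<^sup>2 * (w i * A i j * w j))"
      by (intro sum.cong refl) (simp add: algebra_simps power2_eq_square)
    also have "\<dots> = t\<^sup>2 * Q - 2 * t * W"
      using y 1 2 by (simp add: sum.distrib sum_subtractf sum_distrib_left[symmetric] Q_def)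
    finally show ?thesis .
  qed
  have Q: "0 \<le> Q"
    using A unfolding psd_def Q_def by (elim conjE allE) assumption
  have W: "0 \<le> W" by (simp add: W_def sum_nonneg)
  have "W = 0"
  proof (rule ccontr)
    assume "W \<noteq> 0"
    with W have "W > 0" by simp
    define t where "t = W / (Q + 1)"
    have t: "t > 0" using \<open>W > 0\<close> Q by (simp add: t_def)
    have "t * Q < W" using \<open>W > 0\<close> Q by (simp add: t_def field_simps)
    then have "t * (t * Q) < t * (2 * W)" using t \<open>W > 0\<close> by simp
    then show False using ineq[of t] by (simp add: power2_eq_square algebra_simps)
  qed
  then have "w k * w k = 0"
    unfolding W_def using k by (subst (asm) sum_nonneg_eq_0_iff) auto
  then show ?thesis by (simp add: w_def)
qed

lemma psd_root_unique:
  assumes A: "psd_root p \<Sigma> A" and B: "psd_root p \<Sigma> B"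
    and ij: "i \<in> {1..p}" "j \<in> {1..p}"
  shows "A i j = B i j"
proof -
  have pA: "psd p A" and pB: "psd p B" using A B by (auto simp: psd_root_def)
  define D where "D i j = A i j - B i j" for i j
  define S where "S i j = A i j + B i j" for i j
  have Dsym: "D a b = D b a" if "a \<in> {1..p}" "b \<in> {1..p}" for a b
  proof -
    have "A a b = A b a" "B a b = B b a" using pA pB that unfolding psd_def by blast+
    then show ?thesis by (simp add: D_def)
  qed
  have SD: "(\<Sum>m=1..p. S a m * D m b) + (\<Sum>m=1..p. D a m * S m b) = 0"
    if "a \<in> {1..p}" "b \<in> {1..p}" for a b
  proof -
    have "(\<Sum>m=1..p. S a m * D m b) + (\<Sum>m=1..p. D a m * S m b)
        = 2 * (\<Sum>m=1..p. A a m * A m b) - 2 * (\<Sum>m=1..p. B a m * B m b)"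
      by (simp add: sum.distrib[symmetric] sum_distrib_left sum_subtractf[symmetric] S_def D_def
          algebra_simps)
    then show ?thesis using A B that by (simp add: psd_root_def)
  qed
  define T where "T = (\<Sum>k=1..p. \<Sum>a=1..p. \<Sum>b=1..p. D a k * S a b * D b k)"
  have "T = (\<Sum>k=1..p. \<Sum>a=1..p. D a k * (\<Sum>b=1..p. S a b * D b k))"
    by (simp add: T_def sum_distrib_left mult.assoc)
  also have "\<dots> = (\<Sum>k=1..p. \<Sum>a=1..p. D a k * - (\<Sum>b=1..p. D a b * S b k))"
    using SD by (intro sum.cong refl arg_cong[where f = "(*) _"]) (simp only: eq_neg_iff_add_eq_0)
  also have "\<dots> = - (\<Sum>k=1..p. \<Sum>a=1..p. \<Sum>b=1..p. D a k * D a b * S b k)"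
    by (simp add: sum_negf sum_distrib_left mult.assoc)
  also have "(\<Sum>k=1..p. \<Sum>a=1..p. \<Sum>b=1..p. D a k * D a b * S b k)
      = (\<Sum>a=1..p. \<Sum>b=1..p. \<Sum>k=1..p. D a k * D a b * S b k)"
    by (subst sum.swap) (intro sum.cong refl sum.swap)
  also have "\<dots> = T"
    unfolding T_def by (intro sum.cong refl) (simp add: Dsym mult_ac)
  finally have "T = 0" by simp
  define TA where "TA k = (\<Sum>a=1..p. \<Sum>b=1..p. D a k * A a b * D b k)" for k
  define TB where "TB k = (\<Sum>a=1..p. \<Sum>b=1..p. D a k * B a b * D b k)" for k
  have nA: "0 \<le> TA k" and nB: "0 \<le> TB k" for k
    using pA pB unfolding TA_def TB_def psd_def by simp_all
  have "T = (\<Sum>k=1..p. TA k + TB k)"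
    by (simp add: T_def TA_def TB_def S_def algebra_simps sum.distrib)
  with \<open>T = 0\<close> have "\<forall>k\<in>{1..p}. TA k + TB k = 0"
    using nA nB by (subst (asm) eq_commute) (simp add: sum_nonneg_eq_0_iff)
  with ij nA[of j] nB[of j] have "TA j = 0" "TB j = 0" by fastforce+
  then have *: "(\<Sum>b=1..p. A a b * D b j) = 0" "(\<Sum>b=1..p. B a b * D b j) = 0"
    if "a \<in> {1..p}" for a
    using psd_null[OF pA _ that] psd_null[OF pB _ that] by (simp_all add: TA_def TB_def)
  have "(\<Sum>b=1..p. D j b * D b j) = 0"
    using *[OF ij(2)] by (simp add: D_def[of j] left_diff_distrib sum_subtractf)
  then have "(\<Sum>b=1..p. D b j * D b j) = 0" using Dsym ij by simp
  then have "D i j * D i j = 0" using ij by (subst (asm) sum_nonneg_eq_0_iff) auto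
  then show ?thesis by (simp add: D_def)
qed

lemma psd_root_spiked_cov:
  assumes v: "L2_set v {1..p} = sqrt (real p)" and \<gamma>: "0 \<le> \<gamma>" "\<gamma> \<le> 1" and "p \<ge> 1"
  shows "psd_root p (spiked_cov \<gamma> v) (\<lambda>i j. sqrt (1 - \<gamma>) * (if i = j then 1 else 0)
      + (sqrt (1 - \<gamma> + \<gamma> * p) - sqrt (1 - \<gamma>)) / p * (v i * v j))"
proof -
  define a where "a = sqrt (1 - \<gamma>)"
  define c where "c = sqrt (1 - \<gamma> + \<gamma> * p)"
  define b where "b = (c - a) / p"
  define A where "A i j = a * (if i = j then 1 else 0) + b * (v i * v j)" for i j
  have vv: "(\<Sum>k=1..p. v k * v k) = p"
    using v by (simp add: L2_set_def power2_eq_square)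
  have ac: "a\<^sup>2 = 1 - \<gamma>" "c\<^sup>2 = 1 - \<gamma> + \<gamma> * p" "0 \<le> a" "a \<le> c"
    using \<gamma> by (auto simp: a_def c_def)
  have "p * (2 * a * b + p * b\<^sup>2) = c\<^sup>2 - a\<^sup>2"
    using \<open>p \<ge> 1\<close> by (simp add: b_def field_simps power2_eq_square)
  then have ab: "2 * a * b + p * b\<^sup>2 = \<gamma>"
    using \<open>p \<ge> 1\<close> ac by simp
  have b: "0 \<le> b" using ac by (simp add: b_def)
  have "psd p A"
    unfolding psd_def
  proof (intro conjI ballI allI)
    fix x :: "nat \<Rightarrow> real"
    have "(\<Sum>i=1..p. \<Sum>j=1..p. x i * A i j * x j) =
        (\<Sum>i=1..p. \<Sum>j=1..p. (if i = j then a * (x i * x j) else 0) + b * ((x i * v i) * (x j * v j)))"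
      by (intro sum.cong refl) (simp add: A_def algebra_simps)
    also have "\<dots> = a * (\<Sum>i=1..p. x i * x i) + b * ((\<Sum>i=1..p. x i * v i) * (\<Sum>i=1..p. x i * v i))"
      by (simp add: sum.distrib sum_distrib_left[symmetric] sum_distrib_right[symmetric])
    finally show "0 \<le> (\<Sum>i=1..p. \<Sum>j=1..p. x i * A i j * x j)"
      using b ac by (simp add: sum_nonneg)
  qed (simp add: A_def mult_ac)
  moreover have "(\<Sum>k=1..p. A i k * A k j) = spiked_cov \<gamma> v i j"
    if "i \<in> {1..p}" "j \<in> {1..p}" for i j
  proof -
    have "(\<Sum>k=1..p. A i k * A k j) = (\<Sum>k=1..p. (if i = k then a * A k j else 0)
        + ((if k = j then a * b * (v i * v k) else 0) + b\<^sup>2 * (v i * v j) * (v k * v k)))"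
      by (intro sum.cong refl) (simp add: A_def algebra_simps power2_eq_square)
    also have "\<dots> = a * A i j + (a * b * (v i * v j) + b\<^sup>2 * (v i * v j) * p)"
      using that by (simp add: sum.distrib sum_distrib_left[symmetric] vv[simplified])
    also have "\<dots> = a\<^sup>2 * (if i = j then 1 else 0) + (2 * a * b + p * b\<^sup>2) * (v i * v j)"
      by (simp add: A_def algebra_simps power2_eq_square)
    also have "\<dots> = spiked_cov \<gamma> v i j"
      unfolding ab ac spiked_cov_def ..
    finally show ?thesis .
  qed
  ultimately have "psd_root p (spiked_cov \<gamma> v) A"
    unfolding psd_root_def by blast
  moreover have "A = (\<lambda>i j. sqrt (1 - \<gamma>) * (if i = j then 1 else 0)
      + (sqrt (1 - \<gamma> + \<gamma> * p) - sqrt (1 - \<gamma>)) / p * (v i * v j))"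
    by (intro ext) (simp add: A_def a_def b_def c_def)
  ultimately show ?thesis by simp
qed

subsection \<open>Minimax testing\<close>

definition Theta :: "nat \<Rightarrow> nat \<Rightarrow> real \<Rightarrow> (nat \<Rightarrow> real) set" where
  "Theta p s \<epsilon> = {\<theta> \<in> space (Rp p). L2_set \<theta> {1..p} \<ge> \<epsilon> \<and> norm0 p \<theta> \<le> s}"

definition tests :: "nat \<Rightarrow> ((nat \<Rightarrow> real) \<Rightarrow> nat) set" where
  "tests p = measurable (Rp p) (count_space {0, 1})"

text \<open>
  For \<open>1 \<le> s\<close> and \<open>1 \<le> p\<close> the alternative is nonempty, so that supremum and infimum are over
  nonempty bounded sets of reals.
\<close>

definition risk :: "nat \<Rightarrow> nat \<Rightarrow> real \<Rightarrow> (nat \<Rightarrow> real) \<Rightarrow> real \<Rightarrow> real" where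
  "risk p s \<gamma> v \<epsilon> =
     (INF \<phi> \<in> tests p.
        measure (obs_law p (\<lambda>i\<in>{1..p}. 0) \<gamma> v) {x \<in> space (Rp p). \<phi> x = 1} +
        (SUP \<theta> \<in> Theta p s \<epsilon>. measure (obs_law p \<theta> \<gamma> v) {x \<in> space (Rp p). \<phi> x = 0}))"

text \<open>
  \<open>\<psi>\<close> is the separation rate over a set \<open>D\<close> of parameters \<open>(p, s, \<gamma>, v)\<close>; the constants depend
  on \<open>\<eta>\<close> only. The last clause is the convention for a rate that vanishes.
\<close>

definition separation_rate ::
  "(nat \<times> nat \<times> real \<times> (nat \<Rightarrow> real)) set \<Rightarrow>
   (nat \<Rightarrow> nat \<Rightarrow> real \<Rightarrow> (nat \<Rightarrow> real) \<Rightarrow> real) \<Rightarrow> bool" where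
  "separation_rate D \<psi> \<longleftrightarrow>
     (\<forall>\<eta>\<in>{0<..<1}. \<exists>C\<^sub>\<eta>>0. \<forall>(p, s, \<gamma>, v)\<in>D. \<psi> p s \<gamma> v \<noteq> 0 \<longrightarrow>
        (\<forall>C>C\<^sub>\<eta>. risk p s \<gamma> v (C * \<psi> p s \<gamma> v) \<le> \<eta>)) \<and>
     (\<forall>\<eta>\<in>{0<..<1}. \<exists>c\<^sub>\<eta>>0. \<forall>(p, s, \<gamma>, v)\<in>D. \<psi> p s \<gamma> v \<noteq> 0 \<longrightarrow>
        (\<forall>c. 0 < c \<and> c < c\<^sub>\<eta> \<longrightarrow> risk p s \<gamma> v (c * \<psi> p s \<gamma> v) \<ge> 1 - \<eta>)) \<and>
     (\<forall>(p, s, \<gamma>, v)\<in>D. \<psi> p s \<gamma> v = 0 \<longrightarrow> (\<forall>\<epsilon>>0. risk p s \<gamma> v \<epsilon> = 0))"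

definition omega :: "nat \<Rightarrow> (nat \<Rightarrow> real) \<Rightarrow> nat" where
  "omega p v = Max {s. s \<le> p \<and>
     (MAX S \<in> {S. S \<subseteq> {1..p} \<and> card S \<le> s}. (L2_set (restr v S) {1..p})\<^sup>2) \<le> real p / 4}"

end

theory Submission
  imports Defs "HOL-Real_Asymp.Real_Asymp"
begin

text \<open>
  Write an observation as \<open>X = \<theta> + a Z + b (v \<bullet> Z) v\<close> with \<open>Z\<close> standard normal and
  \<open>a\<^sup>2 = 1 - \<gamma>\<close>. The last term, whose size is not controlled by \<open>a\<close>, is removed by projecting onto
  the complement of \<open>v\<close>. This costs little: for \<open>s \<le> omega p v\<close> a support \<open>S\<close> carries at most a
  quarter of the squared norm of \<open>v\<close>, so that by the Cauchy--Schwarz inequality the projection of \<open>\<theta>\<close>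
  keeps a fixed share of its norm, even when restricted to \<open>S\<close>. After division by \<open>a\<close>, the claim
  becomes the one for independent noise, with squared rate \<open>s ln (1 + p / s\<^sup>2)\<close> or \<open>sqrt p\<close>,
  except for two effects: the projected signal also has nonzero coordinates off \<open>S\<close>, and the
  projected noise is correlated.

  Upper bound (\<open>risk_upper\<close>). The test rejects for large values of the sum of \<open>cosh (t Y\<^sub>i)\<close> over the
  coordinates of the projected and rescaled data \<open>Y\<close>, with \<open>exp (t\<^sup>2) = 1 + p / s\<^sup>2\<close> for
  \<open>s \<le> sqrt p\<close> and \<open>exp (t\<^sup>2) = 2\<close> otherwise. Under the hypothesis, \<open>Y\<close> is the midpoint of \<open>Z\<close> and its
  reflection along \<open>v\<close>, so that convexity reduces the error to independent coordinates
  (\<open>cosh_stat_null\<close>). Under the alternative, the inequality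
  \<open>cosh (x + y) \<ge> cosh x + y sinh x + y\<^sup>2 / 2\<close> around the unprojected noise controls all coordinates
  in the dense case (\<open>cosh_stat_dense\<close>) and those off the support in the sparse case; on the
  support the exponential growth of \<open>cosh\<close> yields the required gain (\<open>cosh_stat_sparse\<close>).

  Lower bound (\<open>risk_lower\<close>). The second moment of the likelihood ratio is computed for a uniform
  prior on sparse vectors whose signs follow those of \<open>v\<close>. With this choice the spike only makes
  the translates less correlated, and the bound for independent noise applies
  (\<open>risk_mixture_lower\<close>). The case \<open>\<gamma> = 1\<close> is settled by \<open>risk_degenerate\<close>.
\<close>

section \<open>Hyperbolic moments of the standard normal law\<close>

text \<open>
The law of a standard normal vector in the space \<open>Rp p\<close>.
\<close>

definition gauss :: "nat \<Rightarrow> (nat \<Rightarrow> real) measure" where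
  "gauss p = PiM {1..p} (\<lambda>_. density lborel std_normal_density)"

text \<open>
The Euclidean inner product over the coordinates \<open>{1..p}\<close>.
\<close>

definition dot :: "nat \<Rightarrow> (nat \<Rightarrow> real) \<Rightarrow> (nat \<Rightarrow> real) \<Rightarrow> real" where
  "dot p x y = (\<Sum>i=1..p. x i * y i)"

lemma dot_commute: "dot p x y = dot p y x"
  by (simp add: dot_def mult.commute)

lemma dot_add_left: "dot p (\<lambda>i. x i + y i) z = dot p x z + dot p y z"
  by (simp add: dot_def sum.distrib algebra_simps)

lemma dot_diff_left: "dot p (\<lambda>i. x i - y i) z = dot p x z - dot p y z"
  by (simp add: dot_def sum_subtractf algebra_simps)

lemma dot_scale_left: "dot p (\<lambda>i. c * x i) z = c * dot p x z"
  by (simp add: dot_def sum_distrib_left mult.assoc)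

lemma dot_add_right: "dot p z (\<lambda>i. x i + y i) = dot p z x + dot p z y"
  by (simp add: dot_def sum.distrib algebra_simps)

lemma dot_diff_right: "dot p z (\<lambda>i. x i - y i) = dot p z x - dot p z y"
  by (simp add: dot_def sum_subtractf algebra_simps)

lemma dot_scale_right: "dot p z (\<lambda>i. c * x i) = c * dot p z x"
  by (simp add: dot_def sum_distrib_left mult_ac)

lemmas dot_linear = dot_add_left dot_diff_left dot_scale_left dot_add_right dot_diff_right
  dot_scale_right

lemma dot_nonneg: "0 \<le> dot p x x"
  by (simp add: dot_def sum_nonneg)

lemma L2_set_dot: "(L2_set x {1..p})\<^sup>2 = dot p x x"
  by (simp add: L2_set_def dot_def power2_eq_square sum_nonneg)

lemma prob_space_gauss: "prob_space (gauss p)"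
  unfolding gauss_def by (intro prob_space_PiM prob_space_normal_density) simp

lemma space_gauss: "space (gauss p) = space (Rp p)"
  by (simp add: gauss_def Rp_def space_PiM)

lemma sets_gauss [measurable_cong]: "sets (gauss p) = sets (Rp p)"
  by (auto simp: gauss_def Rp_def intro!: sets_PiM_cong)

lemma sets_Rp [measurable_cong]: "sets (Rp p) = sets (PiM {1..p} (\<lambda>_. borel))"
  by (simp add: Rp_def)

lemma measurable_dot [measurable]: "(\<lambda>z. dot p l z) \<in> borel_measurable (Rp p)"
  unfolding dot_def by measurable

lemma std_normal_mgf:
  shows "integrable (density lborel std_normal_density) (\<lambda>z. exp (l * z))"
    and "(\<integral>z. exp (l * z) \<partial>density lborel std_normal_density) = exp (l\<^sup>2 / 2)"
proof -
  have eq: "std_normal_density z * exp (l * z) = exp (l\<^sup>2 / 2) * normal_density l 1 z" for z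
    by (simp add: normal_density_def exp_add[symmetric] power2_eq_square field_simps)
  show "integrable (density lborel std_normal_density) (\<lambda>z. exp (l * z))"
    by (subst integrable_density) (auto simp: eq)
  show "(\<integral>z. exp (l * z) \<partial>density lborel std_normal_density) = exp (l\<^sup>2 / 2)"
    by (subst integral_density) (auto simp: eq)
qed

text \<open>
  The moment generating function of the standard normal law. Every moment used below is
  a consequence: products of hyperbolic functions of linear forms are combinations of
  hyperbolic cosines of linear forms.
\<close>

lemma gauss_mgf:
  shows integrable_exp_dot: "integrable (gauss p) (\<lambda>z. exp (dot p l z))"
    and integral_exp_dot: "(\<integral>z. exp (dot p l z) \<partial>gauss p) = exp (dot p l l / 2)"
proof -
  interpret product_prob_space "\<lambda>_. density lborel std_normal_density" "{1..p}"
    by (intro product_prob_spaceI prob_space_normal_density) simp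
  have eq: "exp (dot p l z) = (\<Prod>i\<in>{1..p}. exp (l i * z i))" for z
    by (simp add: dot_def exp_sum)
  show "integrable (gauss p) (\<lambda>z. exp (dot p l z))"
    unfolding eq gauss_def by (intro product_integrable_prod std_normal_mgf) simp
  have "(\<integral>z. exp (dot p l z) \<partial>gauss p) = (\<Prod>i\<in>{1..p}. exp ((l i)\<^sup>2 / 2))"
    unfolding eq gauss_def by (subst product_integral_prod) (auto simp: std_normal_mgf)
  also have "\<dots> = exp (dot p l l / 2)"
    by (simp add: dot_def exp_sum[symmetric] sum_divide_distrib power2_eq_square)
  finally show "(\<integral>z. exp (dot p l z) \<partial>gauss p) = exp (dot p l l / 2)" .
qed

lemma gauss_cosh:
  shows integrable_cosh_dot: "integrable (gauss p) (\<lambda>z. cosh (dot p l z))"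
    and integral_cosh_dot: "(\<integral>z. cosh (dot p l z) \<partial>gauss p) = exp (dot p l l / 2)"
proof -
  define l' where "l' i = - 1 * l i" for i
  have eq: "cosh (dot p l z) = (exp (dot p l z) + exp (dot p l' z)) / 2" for z
    unfolding l'_def dot_scale_left by (simp add: cosh_field_def)
  have l': "dot p l' l' = dot p l l"
    unfolding l'_def dot_linear by simp
  show "integrable (gauss p) (\<lambda>z. cosh (dot p l z))"
    unfolding eq by (intro integrable_divide Bochner_Integration.integrable_add integrable_exp_dot)
  show "(\<integral>z. cosh (dot p l z) \<partial>gauss p) = exp (dot p l l / 2)"
    unfolding eq
    by (subst integral_divide_zero, subst Bochner_Integration.integral_add)
       (simp_all add: integrable_exp_dot integral_exp_dot l')
qed

lemma gauss_cosh_cosh: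
  shows integrable_cosh_cosh: "integrable (gauss p) (\<lambda>z. cosh (dot p x z) * cosh (dot p y z))"
    and integral_cosh_cosh: "(\<integral>z. cosh (dot p x z) * cosh (dot p y z) \<partial>gauss p)
      = exp ((dot p x x + dot p y y) / 2) * cosh (dot p x y)"
proof -
  have eq: "cosh (dot p x z) * cosh (dot p y z)
      = (cosh (dot p (\<lambda>i. x i + y i) z) + cosh (dot p (\<lambda>i. x i - y i) z)) / 2" for z
    unfolding dot_linear by (simp add: cosh_add cosh_diff)
  show "integrable (gauss p) (\<lambda>z. cosh (dot p x z) * cosh (dot p y z))"
    unfolding eq by (intro integrable_divide Bochner_Integration.integrable_add integrable_cosh_dot)
  have "(\<integral>z. cosh (dot p x z) * cosh (dot p y z) \<partial>gauss p)
      = (exp (dot p (\<lambda>i. x i + y i) (\<lambda>i. x i + y i) / 2)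
        + exp (dot p (\<lambda>i. x i - y i) (\<lambda>i. x i - y i) / 2)) / 2"
    unfolding eq
    by (subst integral_divide_zero, subst Bochner_Integration.integral_add)
       (auto simp only: integrable_cosh_dot integral_cosh_dot)
  also have "\<dots> = exp ((dot p x x + dot p y y) / 2) * cosh (dot p x y)"
    unfolding dot_linear dot_commute[of p y x]
    by (simp add: cosh_field_def exp_add[symmetric] field_simps)
  finally show "(\<integral>z. cosh (dot p x z) * cosh (dot p y z) \<partial>gauss p)
      = exp ((dot p x x + dot p y y) / 2) * cosh (dot p x y)" .
qed

lemma gauss_sinh_sinh:
  shows integrable_sinh_sinh: "integrable (gauss p) (\<lambda>z. sinh (dot p x z) * sinh (dot p y z))"
    and integral_sinh_sinh: "(\<integral>z. sinh (dot p x z) * sinh (dot p y z) \<partial>gauss p)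
      = exp ((dot p x x + dot p y y) / 2) * sinh (dot p x y)"
proof -
  have eq: "sinh (dot p x z) * sinh (dot p y z)
      = (cosh (dot p (\<lambda>i. x i + y i) z) - cosh (dot p (\<lambda>i. x i - y i) z)) / 2" for z
    unfolding dot_linear by (simp add: cosh_add cosh_diff)
  show "integrable (gauss p) (\<lambda>z. sinh (dot p x z) * sinh (dot p y z))"
    unfolding eq by (intro integrable_divide Bochner_Integration.integrable_diff integrable_cosh_dot)
  have "(\<integral>z. sinh (dot p x z) * sinh (dot p y z) \<partial>gauss p)
      = (exp (dot p (\<lambda>i. x i + y i) (\<lambda>i. x i + y i) / 2)
        - exp (dot p (\<lambda>i. x i - y i) (\<lambda>i. x i - y i) / 2)) / 2"
    unfolding eq
    by (subst integral_divide_zero, subst Bochner_Integration.integral_diff)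
       (auto simp only: integrable_cosh_dot integral_cosh_dot)
  also have "\<dots> = exp ((dot p x x + dot p y y) / 2) * sinh (dot p x y)"
    unfolding dot_linear dot_commute[of p y x]
    by (simp add: sinh_field_def exp_add[symmetric] field_simps)
  finally show "(\<integral>z. sinh (dot p x z) * sinh (dot p y z) \<partial>gauss p)
      = exp ((dot p x x + dot p y y) / 2) * sinh (dot p x y)" .
qed

text \<open>
  The vectors \<open>l i\<close> are orthogonal with squared norm \<open>t\<^sup>2\<close>, so that the forms \<open>dot p (l i)\<close> are
  independent and centred with variance \<open>t\<^sup>2\<close>: distinct terms of the centred sum are
  uncorrelated, and each term has the variance of \<open>cosh (t * Z)\<close>.
\<close>

lemma cosh_sum_variance:
  assumes I: "finite I"
    and orth: "\<And>i j. i \<in> I \<Longrightarrow> j \<in> I \<Longrightarrow> dot p (l i) (l j) = (if i = j then t\<^sup>2 else 0)"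
  defines "f \<equiv> \<lambda>z. (\<Sum>i\<in>I. cosh (dot p (l i) z) - exp (t\<^sup>2 / 2))\<^sup>2"
  shows "integrable (gauss p) f"
    and "(\<integral>z. f z \<partial>gauss p) = card I * (exp (t\<^sup>2) - 1)\<^sup>2 / 2"
proof -
  define e where "e = exp (t\<^sup>2 / 2)"
  have ee: "e * e = exp (t\<^sup>2)" by (simp add: e_def exp_add[symmetric])
  define g where "g i j z = cosh (dot p (l i) z) * cosh (dot p (l j) z)
      - e * cosh (dot p (l i) z) - e * cosh (dot p (l j) z) + e * e" for i j z
  interpret prob_space "gauss p" by (rule prob_space_gauss)
  have f: "f z = (\<Sum>i\<in>I. \<Sum>j\<in>I. g i j z)" for z
    unfolding f_def e_def[symmetric] unfolding power2_eq_square sum_product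
    by (intro sum.cong refl) (simp add: g_def algebra_simps)
  have int: "integrable (gauss p) (g i j)" for i j
    unfolding g_def by (intro Bochner_Integration.integrable_add Bochner_Integration.integrable_diff
        integrable_mult_right integrable_cosh_cosh integrable_cosh_dot integrable_const)
  have val: "(\<integral>z. g i j z \<partial>gauss p) = (if i = j then (exp (t\<^sup>2) - 1)\<^sup>2 / 2 else 0)"
    if ij: "i \<in> I" "j \<in> I" for i j
  proof -
    have "(\<integral>z. g i j z \<partial>gauss p) = exp ((t\<^sup>2 + t\<^sup>2) / 2) * cosh (dot p (l i) (l j)) - e * e - e * e + e * e"
      unfolding g_def using orth[OF ij(1) ij(1)] orth[OF ij(2) ij(2)]
      by (simp add: integrable_cosh_cosh integrable_cosh_dot integral_cosh_cosh integral_cosh_dot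
          prob_space e_def)
    also have "\<dots> = exp (t\<^sup>2) * (cosh (dot p (l i) (l j)) - 1)"
      unfolding ee by (simp add: algebra_simps)
    also have "\<dots> = (if i = j then (exp (t\<^sup>2) - 1)\<^sup>2 / 2 else 0)"
      unfolding orth[OF ij]
      by (simp add: cosh_field_def exp_minus field_simps power2_eq_square)
    finally show ?thesis .
  qed
  show "integrable (gauss p) f"
    unfolding f by (intro Bochner_Integration.integrable_sum int)
  have "(\<integral>z. f z \<partial>gauss p) = (\<Sum>i\<in>I. \<Sum>j\<in>I. \<integral>z. g i j z \<partial>gauss p)"
    unfolding f by (subst Bochner_Integration.integral_sum, intro Bochner_Integration.integrable_sum int)
      (intro sum.cong refl Bochner_Integration.integral_sum int)
  also have "\<dots> = (\<Sum>i\<in>I. \<Sum>j\<in>I. if i = j then (exp (t\<^sup>2) - 1)\<^sup>2 / 2 else 0)"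
    by (intro sum.cong refl val)
  also have "\<dots> = card I * (exp (t\<^sup>2) - 1)\<^sup>2 / 2"
    using I by simp
  finally show "(\<integral>z. f z \<partial>gauss p) = card I * (exp (t\<^sup>2) - 1)\<^sup>2 / 2" .
qed

lemma sinh_sum_second_moment:
  fixes w :: "nat \<Rightarrow> real"
  assumes I: "finite I"
    and orth: "\<And>i j. i \<in> I \<Longrightarrow> j \<in> I \<Longrightarrow> dot p (l i) (l j) = (if i = j then t\<^sup>2 else 0)"
  defines "f \<equiv> \<lambda>z. (\<Sum>i\<in>I. w i * sinh (dot p (l i) z))\<^sup>2"
  shows "integrable (gauss p) f"
    and "(\<integral>z. f z \<partial>gauss p) = (\<Sum>i\<in>I. (w i)\<^sup>2) * (exp (2 * t\<^sup>2) - 1) / 2"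
proof -
  define g where "g i j z = w i * w j * (sinh (dot p (l i) z) * sinh (dot p (l j) z))" for i j z
  have f: "f z = (\<Sum>i\<in>I. \<Sum>j\<in>I. g i j z)" for z
    unfolding f_def power2_eq_square sum_product
    by (intro sum.cong refl) (simp add: g_def mult_ac)
  have int: "integrable (gauss p) (g i j)" for i j
    unfolding g_def by (intro integrable_mult_right integrable_sinh_sinh)
  have val: "(\<integral>z. g i j z \<partial>gauss p) = (if i = j then (w i)\<^sup>2 * (exp (2 * t\<^sup>2) - 1) / 2 else 0)"
    if ij: "i \<in> I" "j \<in> I" for i j
  proof -
    have "(\<integral>z. g i j z \<partial>gauss p) = w i * w j * (exp (t\<^sup>2) * sinh (dot p (l i) (l j)))"
      unfolding g_def using orth[OF ij(1) ij(1)] orth[OF ij(2) ij(2)]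
      by (simp add: integral_sinh_sinh)
    also have "\<dots> = (if i = j then (w i)\<^sup>2 * (exp (2 * t\<^sup>2) - 1) / 2 else 0)"
      unfolding orth[OF ij] mult_2 exp_add
      by (simp add: sinh_field_def exp_minus field_simps power2_eq_square)
    finally show ?thesis .
  qed
  show "integrable (gauss p) f"
    unfolding f by (intro Bochner_Integration.integrable_sum int)
  have "(\<integral>z. f z \<partial>gauss p) = (\<Sum>i\<in>I. \<Sum>j\<in>I. \<integral>z. g i j z \<partial>gauss p)"
    unfolding f by (subst Bochner_Integration.integral_sum, intro Bochner_Integration.integrable_sum int)
      (intro sum.cong refl Bochner_Integration.integral_sum int)
  also have "\<dots> = (\<Sum>i\<in>I. \<Sum>j\<in>I. if i = j then (w i)\<^sup>2 * (exp (2 * t\<^sup>2) - 1) / 2 else 0)"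
    by (intro sum.cong refl val)
  also have "\<dots> = (\<Sum>i\<in>I. (w i)\<^sup>2) * (exp (2 * t\<^sup>2) - 1) / 2"
    using I by (simp add: sum_distrib_right sum_divide_distrib)
  finally show "(\<integral>z. f z \<partial>gauss p) = (\<Sum>i\<in>I. (w i)\<^sup>2) * (exp (2 * t\<^sup>2) - 1) / 2" .
qed

section \<open>The projected statistic and tail bounds\<close>

text \<open>
The \<open>i\<close>-th vector of the standard basis.
\<close>

definition unit :: "nat \<Rightarrow> nat \<Rightarrow> real" where
  "unit i = (\<lambda>j. if j = i then 1 else 0)"

lemma dot_unit: "i \<in> {1..p} \<Longrightarrow> dot p (unit i) x = x i"
  by (simp add: dot_def unit_def if_distrib[of "\<lambda>x. x * _"] cong: if_cong)

lemma dot_unit_right: "i \<in> {1..p} \<Longrightarrow> dot p x (unit i) = x i"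
  using dot_unit[of i p x] by (simp add: dot_commute)

text \<open>
  The orthogonal projection onto the complement of \<open>v\<close>, for a vector \<open>v\<close> of squared norm \<open>p\<close>.
  It removes the spike of the covariance from an observation.
\<close>

definition proj :: "nat \<Rightarrow> (nat \<Rightarrow> real) \<Rightarrow> (nat \<Rightarrow> real) \<Rightarrow> nat \<Rightarrow> real" where
  "proj p v x = (\<lambda>i. x i - dot p v x / p * v i)"

text \<open>
  The test statistic. As \<open>cosh\<close> is even and grows exponentially, the sum reacts both to a few large
  coordinates and to many small ones; \<open>t\<close> decides how much weight the large ones receive.
\<close>

definition cosh_stat :: "nat \<Rightarrow> (nat \<Rightarrow> real) \<Rightarrow> real \<Rightarrow> (nat \<Rightarrow> real) \<Rightarrow> real" where
  "cosh_stat p v t x = (\<Sum>i=1..p. cosh (t * proj p v x i))"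

lemma measurable_component_Rp: "i \<in> {1..p} \<Longrightarrow> (\<lambda>z. z i) \<in> borel_measurable (Rp p)"
  unfolding Rp_def by (rule measurable_component_singleton)

lemma borel_measurable_cosh [measurable (raw)]:
  fixes f :: "'a \<Rightarrow> real"
  assumes [measurable]: "f \<in> borel_measurable M"
  shows "(\<lambda>x. cosh (f x)) \<in> borel_measurable M"
  unfolding cosh_field_def by measurable

lemma borel_measurable_sinh [measurable (raw)]:
  fixes f :: "'a \<Rightarrow> real"
  assumes [measurable]: "f \<in> borel_measurable M"
  shows "(\<lambda>x. sinh (f x)) \<in> borel_measurable M"
  unfolding sinh_field_def by measurable

lemma measurable_proj:
  assumes [simp]: "i \<in> {1..p}"
  shows "(\<lambda>z. proj p v z i) \<in> borel_measurable (Rp p)"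
proof -
  note measurable_component_Rp[OF assms, measurable]
  show ?thesis unfolding proj_def by measurable
qed

lemma measurable_cosh_stat [measurable]: "cosh_stat p v t \<in> borel_measurable (Rp p)"
proof -
  have "(\<lambda>x. cosh (t * proj p v x i)) \<in> borel_measurable (Rp p)" if "i \<in> {1..p}" for i
  proof -
    note measurable_proj[OF that, measurable]
    show ?thesis by measurable
  qed
  then show ?thesis unfolding cosh_stat_def[abs_def] by (intro borel_measurable_sum)
qed

text \<open>
  The function \<open>cosh u - u\<^sup>2 / 2\<close> is convex, hence lies above its tangents.
\<close>

lemma cosh_Taylor:
  fixes x y :: real
  shows "cosh x + y * sinh x + y\<^sup>2 / 2 \<le> cosh (x + y)"
proof -
  let ?f = "\<lambda>u::real. cosh u - u\<^sup>2 / 2"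
  have "convex_on UNIV ?f"
    by (rule f''_ge0_imp_convex[where f' = "\<lambda>u. sinh u - u" and f'' = "\<lambda>u. cosh u - 1"])
       (auto intro!: derivative_eq_intros simp: cosh_real_ge_1)
  then have "?f (x + y) - ?f x \<ge> (sinh x - x) * ((x + y) - x)"
    by (rule convex_on_imp_above_tangent) (auto intro!: derivative_eq_intros)
  then show ?thesis by (simp add: algebra_simps power2_eq_square add_divide_distrib)
qed

lemma gauss_tail:
  assumes f: "integrable (gauss p) f" "\<And>z. 0 \<le> f z" and r: "0 < r"
    and sub: "\<And>z. z \<in> space (Rp p) \<Longrightarrow> P z \<Longrightarrow> r \<le> f z"
    and E: "(\<integral>z. f z \<partial>gauss p) \<le> r * b"
  shows "measure (gauss p) {z \<in> space (Rp p). P z} \<le> b"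
proof -
  interpret prob_space "gauss p" by (rule prob_space_gauss)
  note [measurable] = borel_measurable_integrable[OF f(1)]
  have "measure (gauss p) {z \<in> space (Rp p). P z} \<le> measure (gauss p) {z \<in> space (gauss p). r \<le> f z}"
    using sub by (intro finite_measure_mono) (auto simp: space_gauss)
  also have "\<dots> \<le> (\<integral>z. f z \<partial>gauss p) / r"
    using f r by (intro integral_Markov_inequality_measure[where A = "{}"]) auto
  also have "\<dots> \<le> b" using E r by (simp add: field_simps)
  finally show ?thesis .
qed

lemma cosh_sum_tail:
  assumes I: "finite I" "card I \<le> p"
    and orth: "\<And>i j. i \<in> I \<Longrightarrow> j \<in> I \<Longrightarrow> dot p (l i) (l j) = (if i = j then t\<^sup>2 else 0)"
    and K: "K > 0" and p: "p \<ge> 1"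
  shows "measure (gauss p) {z \<in> space (Rp p). K * sqrt p * exp (t\<^sup>2)
      \<le> \<bar>(\<Sum>i\<in>I. cosh (dot p (l i) z)) - card I * exp (t\<^sup>2 / 2)\<bar>} \<le> 1 / (2 * K\<^sup>2)"
proof (rule gauss_tail)
  let ?f = "\<lambda>z. (\<Sum>i\<in>I. cosh (dot p (l i) z) - exp (t\<^sup>2 / 2))\<^sup>2"
  show "integrable (gauss p) ?f" by (rule cosh_sum_variance(1)[OF I(1) orth])
  show "0 < (K * sqrt p * exp (t\<^sup>2))\<^sup>2" using K p by simp
  show "(K * sqrt p * exp (t\<^sup>2))\<^sup>2 \<le> ?f z"
    if "K * sqrt p * exp (t\<^sup>2) \<le> \<bar>(\<Sum>i\<in>I. cosh (dot p (l i) z)) - card I * exp (t\<^sup>2 / 2)\<bar>" for z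
    using power_mono[OF that, of 2] K by (simp add: sum_subtractf)
  have "(\<integral>z. ?f z \<partial>gauss p) = card I * (exp (t\<^sup>2) - 1)\<^sup>2 / 2"
    by (rule cosh_sum_variance(2)[OF I(1) orth])
  also have "\<dots> \<le> p * (exp (t\<^sup>2))\<^sup>2 / 2"
    using I by (intro divide_right_mono mult_mono power_mono) auto
  also have "\<dots> = (K * sqrt p * exp (t\<^sup>2))\<^sup>2 * (1 / (2 * K\<^sup>2))"
    using K by (simp add: power_mult_distrib field_simps)
  finally show "(\<integral>z. ?f z \<partial>gauss p) \<le> (K * sqrt p * exp (t\<^sup>2))\<^sup>2 * (1 / (2 * K\<^sup>2))" .
qed simp

lemma dot_scaled_units:
  assumes "i \<in> {1..p}" "j \<in> {1..p}"
  shows "dot p (\<lambda>k. t * unit i k) (\<lambda>k. t * unit j k) = (if i = j then t\<^sup>2 else 0)"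
  unfolding dot_linear using assms by (simp add: dot_unit) (simp add: unit_def power2_eq_square)

lemma cosh_sum_lower_tail:
  assumes I: "I \<subseteq> {1..p}" and K: "K > 0" and p: "p \<ge> 1"
  shows "measure (gauss p) {z \<in> space (Rp p).
      (\<Sum>i\<in>I. cosh (t * z i)) < card I * exp (t\<^sup>2 / 2) - K * sqrt p * exp (t\<^sup>2)} \<le> 1 / (2 * K\<^sup>2)"
proof -
  interpret prob_space "gauss p" by (rule prob_space_gauss)
  let ?l = "\<lambda>i k. t * unit i k"
  have eq: "(\<Sum>i\<in>I. cosh (dot p (?l i) z)) = (\<Sum>i\<in>I. cosh (t * z i))" for z
    unfolding dot_linear using I by (intro sum.cong refl) (auto simp: dot_unit)
  have fin: "finite I" using I finite_subset by blast
  have I': "card I \<le> p" using card_mono[OF _ I] by simp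
  have [measurable]: "(\<lambda>z. \<Sum>i\<in>I. cosh (dot p (?l i) z)) \<in> borel_measurable (Rp p)"
    by measurable
  have "measure (gauss p) {z \<in> space (Rp p).
      (\<Sum>i\<in>I. cosh (t * z i)) < card I * exp (t\<^sup>2 / 2) - K * sqrt p * exp (t\<^sup>2)}
    \<le> measure (gauss p) {z \<in> space (Rp p). K * sqrt p * exp (t\<^sup>2)
      \<le> \<bar>(\<Sum>i\<in>I. cosh (dot p (?l i) z)) - card I * exp (t\<^sup>2 / 2)\<bar>}"
    unfolding eq[symmetric]
    by (rule finite_measure_mono) (auto simp: sets_gauss intro!: sets_gauss)
  also have "\<dots> \<le> 1 / (2 * K\<^sup>2)"
    using I by (intro cosh_sum_tail fin I' K p dot_scaled_units) auto
  finally show ?thesis .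
qed

lemma sinh_sum_tail:
  assumes I: "I \<subseteq> {1..p}" and K: "K > 0" and R: "(\<Sum>i\<in>I. (w i)\<^sup>2) \<le> R" "R > 0"
  shows "measure (gauss p) {z \<in> space (Rp p).
      K\<^sup>2 * R * (exp (t\<^sup>2))\<^sup>2 \<le> (\<Sum>i\<in>I. w i * sinh (t * z i))\<^sup>2} \<le> 1 / (2 * K\<^sup>2)"
proof (rule gauss_tail)
  let ?l = "\<lambda>i k. t * unit i k"
  let ?f = "\<lambda>z. (\<Sum>i\<in>I. w i * sinh (dot p (?l i) z))\<^sup>2"
  have fin: "finite I" using I finite_subset by blast
  have orth: "dot p (?l i) (?l j) = (if i = j then t\<^sup>2 else 0)" if "i \<in> I" "j \<in> I" for i j
    using that I by (intro dot_scaled_units) auto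
  have eq: "(\<Sum>i\<in>I. w i * sinh (dot p (?l i) z)) = (\<Sum>i\<in>I. w i * sinh (t * z i))" for z
    unfolding dot_linear using I by (intro sum.cong refl) (auto simp: dot_unit)
  show "integrable (gauss p) ?f" by (rule sinh_sum_second_moment(1)[OF fin orth])
  show "K\<^sup>2 * R * (exp (t\<^sup>2))\<^sup>2 > 0" using K R by simp
  show "K\<^sup>2 * R * (exp (t\<^sup>2))\<^sup>2 \<le> ?f z"
    if "K\<^sup>2 * R * (exp (t\<^sup>2))\<^sup>2 \<le> (\<Sum>i\<in>I. w i * sinh (t * z i))\<^sup>2" for z
    using that unfolding eq .
  have "(\<integral>z. ?f z \<partial>gauss p) = (\<Sum>i\<in>I. (w i)\<^sup>2) * (exp (2 * t\<^sup>2) - 1) / 2"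
    by (rule sinh_sum_second_moment(2)[OF fin orth])
  also have "\<dots> \<le> R * (exp (t\<^sup>2))\<^sup>2 / 2"
    using R by (intro divide_right_mono mult_mono) (auto simp: exp_double[symmetric])
  also have "\<dots> = K\<^sup>2 * R * (exp (t\<^sup>2))\<^sup>2 * (1 / (2 * K\<^sup>2))"
    using K by (simp add: field_simps)
  finally show "(\<integral>z. ?f z \<partial>gauss p) \<le> K\<^sup>2 * R * (exp (t\<^sup>2))\<^sup>2 * (1 / (2 * K\<^sup>2))" .
qed simp

lemma dot_tail:
  assumes l: "dot p l l \<le> 1" and K: "K > 0"
  shows "measure (gauss p) {z \<in> space (Rp p). K < \<bar>dot p l z\<bar>} \<le> 4 / K\<^sup>2"
proof (rule gauss_tail)
  show "integrable (gauss p) (\<lambda>z. cosh (dot p l z))" by (rule integrable_cosh_dot)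
  show "0 < K\<^sup>2 / 2" using K by simp
  show "K\<^sup>2 / 2 \<le> cosh (dot p l z)" if "K < \<bar>dot p l z\<bar>" for z
  proof -
    have "K\<^sup>2 \<le> \<bar>dot p l z\<bar>\<^sup>2" using that K by (intro power_mono) auto
    moreover have "\<bar>dot p l z\<bar>\<^sup>2 / 2 \<le> cosh (dot p l z)"
      using cosh_Taylor[of 0 "dot p l z"] by simp
    ultimately show ?thesis by simp
  qed
  have "(\<integral>z. cosh (dot p l z) \<partial>gauss p) \<le> exp (1 / 2)"
    using l by (simp add: integral_cosh_dot)
  also have "exp (1 / 2 :: real) \<le> 2"
    using exp_bound_half[of "1/2::real"] by simp
  finally show "(\<integral>z. cosh (dot p l z) \<partial>gauss p) \<le> K\<^sup>2 / 2 * (4 / K\<^sup>2)" using K by simp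
qed simp

section \<open>The statistic under the hypothesis and under dense alternatives\<close>

lemma gauss_Collect_Un:
  assumes A: "measure (gauss p) {z \<in> space (Rp p). A z} \<le> a" "{z \<in> space (Rp p). A z} \<in> sets (Rp p)"
    and B: "measure (gauss p) {z \<in> space (Rp p). B z} \<le> b" "{z \<in> space (Rp p). B z} \<in> sets (Rp p)"
    and sub: "\<And>z. z \<in> space (Rp p) \<Longrightarrow> C z \<Longrightarrow> A z \<or> B z"
  shows "measure (gauss p) {z \<in> space (Rp p). C z} \<le> a + b"
proof -
  interpret prob_space "gauss p" by (rule prob_space_gauss)
  have "measure (gauss p) {z \<in> space (Rp p). C z}
      \<le> measure (gauss p) ({z \<in> space (Rp p). A z} \<union> {z \<in> space (Rp p). B z})"
    using A B sub by (intro finite_measure_mono) (auto simp: sets_gauss)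
  also have "\<dots> \<le> measure (gauss p) {z \<in> space (Rp p). A z} + measure (gauss p) {z \<in> space (Rp p). B z}"
    using A B by (intro measure_Un_le) (auto simp: sets_gauss)
  finally show ?thesis using A B by simp
qed

lemma measurable_coord_sum:
  assumes "\<And>i. i \<in> I \<Longrightarrow> f i \<in> borel_measurable borel" "I \<subseteq> {1..p}"
  shows "(\<lambda>z. \<Sum>i\<in>I. f i (z i) :: real) \<in> borel_measurable (Rp p)"
proof (intro borel_measurable_sum)
  fix i assume "i \<in> I"
  then show "(\<lambda>z. f i (z i)) \<in> borel_measurable (Rp p)"
    using assms by (intro measurable_compose[OF measurable_component_Rp, of i p "f i"]) auto
qed

text \<open>
  With \<open>R\<close> the reflection in the hyperplane orthogonal to \<open>v\<close>, the projection of \<open>z\<close> is the midpoint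
  of \<open>z\<close> and \<open>R z\<close>. As \<open>cosh\<close> is convex, the statistic is at most the mean of the unprojected
  statistics of \<open>z\<close> and \<open>R z\<close>, and the coordinates of either vector are independent standard normal.
\<close>

lemma cosh_stat_null:
  assumes p: "p \<ge> 1" and v: "dot p v v = p" and K: "K > 0"
  shows "measure (gauss p) {z \<in> space (Rp p).
      p * exp (t\<^sup>2 / 2) + K * sqrt p * exp (t\<^sup>2) \<le> cosh_stat p v t z} \<le> 1 / K\<^sup>2"
proof -
  interpret prob_space "gauss p" by (rule prob_space_gauss)
  let ?l = "\<lambda>i k. t * unit i k"
  \<comment> \<open>The rows of the reflection, scaled by \<open>t\<close>.\<close>
  define r where "r i k = t * (unit i k - (2 * v i / p) * v k)" for i k
  define A where "A l z \<longleftrightarrow> K * sqrt p * exp (t\<^sup>2)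
      \<le> \<bar>(\<Sum>i\<in>{1..p}. cosh (dot p (l i) z)) - card {1..p} * exp (t\<^sup>2 / 2)\<bar>" for l z
  have orth_r: "dot p (r i) (r j) = (if i = j then t\<^sup>2 else 0)" if "i \<in> {1..p}" "j \<in> {1..p}" for i j
  proof -
    have "dot p (r i) (r j) = t * (t * (dot p (unit i) (unit j) - 2 * v i / p * v j - 2 * v j / p * v i
        + 2 * v i / p * (2 * v j / p) * p))"
      using that unfolding r_def dot_linear v by (simp add: dot_unit dot_unit_right algebra_simps)
    also have "\<dots> = t * (t * dot p (unit i) (unit j))"
      using p by (simp add: field_simps)
    also have "\<dots> = (if i = j then t\<^sup>2 else 0)"
      using dot_scaled_units[OF that, of t] by (simp add: dot_linear)
    finally show ?thesis .
  qed
  have tail: "measure (gauss p) {z \<in> space (Rp p). A l z} \<le> 1 / (2 * K\<^sup>2)"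
    if "\<And>i j. i \<in> {1..p} \<Longrightarrow> j \<in> {1..p} \<Longrightarrow> dot p (l i) (l j) = (if i = j then t\<^sup>2 else 0)" for l
    unfolding A_def by (rule cosh_sum_tail) (use that K p in auto)
  have meas: "{z \<in> space (Rp p). A l z} \<in> sets (Rp p)" for l
    unfolding A_def by measurable
  have "measure (gauss p) {z \<in> space (Rp p). p * exp (t\<^sup>2 / 2) + K * sqrt p * exp (t\<^sup>2) \<le> cosh_stat p v t z}
      \<le> 1 / (2 * K\<^sup>2) + 1 / (2 * K\<^sup>2)"
  proof (rule gauss_Collect_Un[OF tail meas tail meas])
    show "dot p (?l i) (?l j) = (if i = j then t\<^sup>2 else 0)" if "i \<in> {1..p}" "j \<in> {1..p}" for i j
      using that by (rule dot_scaled_units)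
    show "dot p (r i) (r j) = (if i = j then t\<^sup>2 else 0)" if "i \<in> {1..p}" "j \<in> {1..p}" for i j
      using that by (rule orth_r)
    fix z assume z: "p * exp (t\<^sup>2 / 2) + K * sqrt p * exp (t\<^sup>2) \<le> cosh_stat p v t z"
    have "cosh_stat p v t z \<le> (\<Sum>i=1..p. (cosh (dot p (?l i) z) + cosh (dot p (r i) z)) / 2)"
      unfolding cosh_stat_def
    proof (intro sum_mono)
      fix i assume i: "i \<in> {1..p}"
      define w where "w = t * (dot p v z / p * v i)"
      have 1: "dot p (?l i) z = t * proj p v z i + w" "dot p (r i) z = t * proj p v z i - w"
        unfolding r_def dot_linear using i by (auto simp: dot_unit proj_def w_def algebra_simps)
      have "cosh (t * proj p v z i) * 1 \<le> cosh (t * proj p v z i) * cosh w"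
        by (intro mult_left_mono) (auto simp: cosh_real_ge_1)
      then show "cosh (t * proj p v z i) \<le> (cosh (dot p (?l i) z) + cosh (dot p (r i) z)) / 2"
        unfolding 1 by (simp add: cosh_add cosh_diff)
    qed
    also have "\<dots> = ((\<Sum>i=1..p. cosh (dot p (?l i) z)) + (\<Sum>i=1..p. cosh (dot p (r i) z))) / 2"
      by (simp add: sum.distrib sum_divide_distrib[symmetric] add_divide_distrib)
    finally show "A ?l z \<or> A r z"
      using z unfolding A_def by (auto simp: abs_if)
  qed
  then show ?thesis by simp
qed

lemma proj_add: "proj p v (\<lambda>i. x i + y i) i = proj p v x i + proj p v y i"
  by (simp add: proj_def dot_linear add_divide_distrib algebra_simps)

lemma dot_proj_right:
  assumes "p \<ge> 1" "dot p v v = p"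
  shows "dot p v (proj p v x) = 0"
  unfolding proj_def dot_linear using assms by simp

lemma dot_proj_proj:
  assumes "p \<ge> 1" "dot p v v = p"
  shows "dot p (proj p v x) (proj p v x) = dot p x x - (dot p v x)\<^sup>2 / p"
proof -
  have "dot p (proj p v x) (proj p v x) = dot p x (proj p v x) - dot p v x / p * dot p v (proj p v x)"
    by (subst (1) proj_def, unfold dot_linear) simp
  also have "\<dots> = dot p x x - (dot p v x)\<^sup>2 / p"
    unfolding dot_proj_right[OF assms] unfolding proj_def dot_linear
    by (simp add: dot_commute[of p x v] power2_eq_square)
  finally show ?thesis .
qed

text \<open>
  A mean whose projection has squared norm of order \<open>sqrt p\<close> is detected with \<open>t\<^sup>2 = ln 2\<close>, whatever
  the number of its nonzero coordinates. The expansion of \<open>cosh\<close> around the unprojected noise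
  has a quadratic term of order \<open>M\<^sup>2\<close>, with \<open>M\<close> the norm of the projected mean; this exceeds the
  fluctuations, which are of order \<open>sqrt p\<close>, \<open>M\<close> and \<open>1\<close>.
\<close>

lemma cosh_stat_dense:
  assumes p: "p \<ge> 1" and v: "dot p v v = p" and K: "K \<ge> 1" and t: "t\<^sup>2 = ln 2" "t > 0"
    and m: "(256 * K\<^sup>2 + 32 * K) * sqrt p \<le> dot p (proj p v \<mu>) (proj p v \<mu>)"
  shows "measure (gauss p) {z \<in> space (Rp p).
      cosh_stat p v t (\<lambda>i. \<mu> i + z i) < p * exp (t\<^sup>2 / 2) + K * sqrt p * exp (t\<^sup>2)} \<le> 3 / (2 * K\<^sup>2)"
proof -
  define q where "q = exp (t\<^sup>2)"
  have q: "q = 2" using t by (simp add: q_def)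
  define m where "m = proj p v \<mu>"
  define M where "M = sqrt (dot p m m)"
  have MM: "M\<^sup>2 = dot p m m" and M0: "M \<ge> 0" by (simp_all add: M_def dot_nonneg)
  have sp: "sqrt p \<ge> 1" using p by simp
  have Mlow: "M\<^sup>2 \<ge> (256 * K\<^sup>2 + 32 * K) * sqrt p" using m by (simp add: MM m_def)
  have t1: "t \<le> 1" 
  proof -
    have "t\<^sup>2 \<le> 1\<^sup>2" using t ln_2_less_1 by simp
    then show ?thesis using power2_le_imp_le[of t 1] by simp
  qed
  have t2: "t\<^sup>2 \<ge> 1 / 2" using t ln2_ge_two_thirds by simp
  have Kp: "256 * K\<^sup>2 \<le> M\<^sup>2"
  proof -
    have "256 * K\<^sup>2 * 1 \<le> (256 * K\<^sup>2 + 32 * K) * sqrt p" using K sp by (intro mult_mono) auto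
    with Mlow show ?thesis by simp
  qed
  then have "(16 * K)\<^sup>2 \<le> M\<^sup>2" by (simp add: power_mult_distrib)
  then have M16: "16 * K \<le> M" using M0 power2_le_imp_le by blast
  with K have Mpos: "0 < M" by simp
  define A where "A z \<longleftrightarrow> (\<Sum>i\<in>{1..p}. cosh (t * z i)) < card {1..p} * exp (t\<^sup>2 / 2) - K * sqrt p * exp (t\<^sup>2)" for z
  define B1 where "B1 z \<longleftrightarrow> K\<^sup>2 * M\<^sup>2 * (exp (t\<^sup>2))\<^sup>2 \<le> (\<Sum>i\<in>{1..p}. m i * sinh (t * z i))\<^sup>2" for z
  define B2 where "B2 z \<longleftrightarrow> K\<^sup>2 * p * (exp (t\<^sup>2))\<^sup>2 \<le> (\<Sum>i\<in>{1..p}. v i * sinh (t * z i))\<^sup>2" for z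
  have pA: "measure (gauss p) {z \<in> space (Rp p). A z} \<le> 1 / (2 * K\<^sup>2)"
    unfolding A_def using K p by (intro cosh_sum_lower_tail) auto
  have pB1: "measure (gauss p) {z \<in> space (Rp p). B1 z} \<le> 1 / (2 * K\<^sup>2)"
  proof -
    have "(\<Sum>i\<in>{1..p}. (m i)\<^sup>2) = M\<^sup>2" unfolding MM dot_def by (simp add: power2_eq_square)
    then show ?thesis unfolding B1_def using K Mpos by (intro sinh_sum_tail) auto
  qed
  have pB2: "measure (gauss p) {z \<in> space (Rp p). B2 z} \<le> 1 / (2 * K\<^sup>2)"
    unfolding B2_def using K p v by (intro sinh_sum_tail) (auto simp: dot_def power2_eq_square)
  have [measurable]: "(\<lambda>z. \<Sum>i\<in>{1..p}. cosh (t * z i)) \<in> borel_measurable (Rp p)"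
    "(\<lambda>z. \<Sum>i\<in>{1..p}. m i * sinh (t * z i)) \<in> borel_measurable (Rp p)"
    "(\<lambda>z. \<Sum>i\<in>{1..p}. v i * sinh (t * z i)) \<in> borel_measurable (Rp p)"
    by (intro measurable_coord_sum; simp)+
  have mA: "{z \<in> space (Rp p). A z} \<in> sets (Rp p)" and mB1: "{z \<in> space (Rp p). B1 z} \<in> sets (Rp p)"
    and mB2: "{z \<in> space (Rp p). B2 z} \<in> sets (Rp p)"
    unfolding A_def B1_def B2_def by measurable
  have pB: "measure (gauss p) {z \<in> space (Rp p). B1 z \<or> B2 z} \<le> 1 / (2 * K\<^sup>2) + 1 / (2 * K\<^sup>2)"
    by (rule gauss_Collect_Un[OF pB1 mB1 pB2 mB2])
  have mB: "{z \<in> space (Rp p). B1 z \<or> B2 z} \<in> sets (Rp p)"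
    using mB1 mB2 unfolding B1_def B2_def by measurable
  have "measure (gauss p) {z \<in> space (Rp p). cosh_stat p v t (\<lambda>i. \<mu> i + z i)
      < p * exp (t\<^sup>2 / 2) + K * sqrt p * exp (t\<^sup>2)} \<le> 1 / (2 * K\<^sup>2) + (1 / (2 * K\<^sup>2) + 1 / (2 * K\<^sup>2))"
  proof (rule gauss_Collect_Un[OF pA mA pB mB], rule ccontr)
    fix z assume z: "cosh_stat p v t (\<lambda>i. \<mu> i + z i) < p * exp (t\<^sup>2 / 2) + K * sqrt p * exp (t\<^sup>2)"
      and neg: "\<not> (A z \<or> B1 z \<or> B2 z)"
    define g where "g = dot p v z / p"
    define U1 where "U1 = (\<Sum>i\<in>{1..p}. m i * sinh (t * z i))"
    define U2 where "U2 = (\<Sum>i\<in>{1..p}. v i * sinh (t * z i))"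
    have "U1\<^sup>2 < K\<^sup>2 * M\<^sup>2 * q\<^sup>2" using neg by (simp add: B1_def U1_def q_def)
    then have "\<bar>U1\<bar>\<^sup>2 < (2 * K * M)\<^sup>2" by (simp add: q power_mult_distrib mult_ac)
    then have U1: "\<bar>U1\<bar> < 2 * K * M" by (rule power_less_imp_less_base) (use K M0 in simp)
    have U2: "U2\<^sup>2 < 4 * K\<^sup>2 * p" using neg by (simp add: B2_def U2_def q_def[symmetric] q)
    have A: "(\<Sum>i=1..p. cosh (t * z i)) \<ge> p * exp (t\<^sup>2 / 2) - K * sqrt p * q"
      using neg by (simp add: A_def q_def)
    \<comment> \<open>The displacement of the projected data from the unprojected noise. Its two parts are orthogonal.\<close>
    define d where "d i = m i - g * v i" for i
    have pz: "proj p v (\<lambda>i. \<mu> i + z i) i = z i + d i" for i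
      by (simp add: proj_add m_def d_def g_def) (simp add: proj_def)
    have dd: "(\<Sum>i=1..p. (d i)\<^sup>2) = M\<^sup>2 + g\<^sup>2 * p"
    proof -
      have "(\<Sum>i=1..p. (d i)\<^sup>2) = dot p d d" by (simp add: dot_def power2_eq_square)
      also have "\<dots> = dot p m m - 2 * g * dot p v m + g * (g * dot p v v)"
        unfolding d_def dot_linear dot_commute[of p m v] by (simp add: algebra_simps)
      also have "\<dots> = M\<^sup>2 + g\<^sup>2 * p"
        using dot_proj_right[OF p v, of \<mu>] unfolding MM m_def by (simp add: v power2_eq_square)
      finally show ?thesis .
    qed
    have "cosh_stat p v t (\<lambda>i. \<mu> i + z i) = (\<Sum>i=1..p. cosh (t * z i + t * d i))"
      by (simp add: cosh_stat_def pz distrib_left)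
    also have "\<dots> \<ge> (\<Sum>i=1..p. cosh (t * z i) + t * d i * sinh (t * z i) + (t * d i)\<^sup>2 / 2)"
      by (intro sum_mono cosh_Taylor)
    also have "(\<Sum>i=1..p. cosh (t * z i) + t * d i * sinh (t * z i) + (t * d i)\<^sup>2 / 2)
        = (\<Sum>i=1..p. cosh (t * z i)) + t * (U1 - g * U2) + t\<^sup>2 / 2 * (M\<^sup>2 + g\<^sup>2 * p)"
    proof -
      have "U1 - g * U2 = (\<Sum>i=1..p. d i * sinh (t * z i))"
        by (simp add: U1_def U2_def d_def sum_distrib_left sum_subtractf[symmetric] algebra_simps)
      then show ?thesis
        unfolding dd[symmetric]
        by (simp add: sum.distrib sum_distrib_left power_mult_distrib mult.assoc)
    qed
    finally have T: "cosh_stat p v t (\<lambda>i. \<mu> i + z i)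
        \<ge> (p * exp (t\<^sup>2 / 2) - K * sqrt p * q) + t * U1 + (t\<^sup>2 / 2 * (g\<^sup>2 * p) - t * g * U2) + t\<^sup>2 / 2 * M\<^sup>2"
      using A by (simp add: algebra_simps)
    have 1: "t * U1 \<ge> - (2 * K * M)"
    proof -
      have "\<bar>t * U1\<bar> \<le> 1 * (2 * K * M)"
        unfolding abs_mult using U1 t t1 by (intro mult_mono) auto
      then show ?thesis by simp
    qed
    have 2: "t\<^sup>2 / 2 * (g\<^sup>2 * p) - t * g * U2 \<ge> - (2 * K\<^sup>2)"
    proof -
      define X where "X = t\<^sup>2 / 2 * (g\<^sup>2 * p) - t * g * U2"
      have "0 \<le> (t * g * p - U2)\<^sup>2" by simp
      also have "\<dots> = 2 * (p * X) + U2\<^sup>2"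
        by (simp add: X_def power2_eq_square algebra_simps)
      finally have "p * (- (2 * K\<^sup>2)) \<le> p * X"
        using U2 by (simp add: mult_ac)
      then show ?thesis unfolding X_def[symmetric] using p by (subst (asm) mult_le_cancel_left_pos) auto
    qed
    have 3: "t\<^sup>2 / 2 * M\<^sup>2 \<ge> M\<^sup>2 / 4"
      using mult_right_mono[OF t2, of "M\<^sup>2"] by simp
    \<comment> \<open>One half of the quadratic term pays for the linear term, the other half for the rest.\<close>
    have 4: "M\<^sup>2 / 8 \<ge> 2 * K * M"
      using mult_right_mono[OF M16 M0] by (simp add: power2_eq_square)
    have 5: "M\<^sup>2 / 8 \<ge> 2 * K\<^sup>2 + 4 * K * sqrt p"
    proof -
      have "256 * K\<^sup>2 * 1 \<le> 256 * K\<^sup>2 * sqrt p" using sp by (intro mult_left_mono) auto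
      moreover have "0 \<le> K\<^sup>2 * 1" by simp
      ultimately have "8 * (2 * K\<^sup>2 + 4 * K * sqrt p) \<le> (256 * K\<^sup>2 + 32 * K) * sqrt p"
        unfolding distrib_right distrib_left by linarith
      from order_trans[OF this Mlow] show ?thesis by (simp add: field_simps)
    qed
    have "p * exp (t\<^sup>2 / 2) + K * sqrt p * q \<le> cosh_stat p v t (\<lambda>i. \<mu> i + z i)"
      using T 1 2 3 4 5 unfolding q by linarith
    with z show False by (simp add: q_def)
  qed
  then show ?thesis by simp
qed

section \<open>The statistic under sparse alternatives\<close>

text \<open>
  A lower bound of \<open>cosh (t * max 0 (x - K))\<close> that is affine in \<open>x\<^sup>2\<close>, so that it can be summed over
  coordinates of which only the sum of squares is controlled. For \<open>x\<close> well above \<open>t\<close> it holds because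
  \<open>exp (t * x)\<close> is the power \<open>x / t\<close> of \<open>exp (t\<^sup>2)\<close>.
\<close>

lemma cosh_growth:
  fixes K D :: real
  assumes K: "K > 0" and D: "D > 0"
  obtains C where "C > 0"
    "\<And>t x. t > 0 \<Longrightarrow> t\<^sup>2 \<ge> ln 2 \<Longrightarrow> x \<ge> 0 \<Longrightarrow>
      2 * D * (exp (t\<^sup>2))\<^sup>2 * (x\<^sup>2 / (C * t\<^sup>2) - 1 / 2) \<le> cosh (t * max 0 (x - K))"
proof -
  have "eventually (\<lambda>u::real. 4 * D * u\<^sup>2 \<le> exp (ln 2 * (u - 2 - 2 * K))) at_top"
    by real_asymp
  then obtain u1 where u1: "\<And>u. u \<ge> u1 \<Longrightarrow> 4 * D * u\<^sup>2 \<le> exp (ln 2 * (u - 2 - 2 * K))"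
    by (auto simp: eventually_at_top_linorder)
  define u0 where "u0 = max u1 (2 + 2 * K)"
  have u0: "u0 \<ge> u1" "u0 \<ge> 2 + 2 * K" by (auto simp: u0_def)
  define C where "C = 2 * u0\<^sup>2"
  have C1: "C \<ge> 1"
  proof -
    have "1 \<le> u0\<^sup>2" using u0 K by (simp add: one_le_power)
    then show ?thesis by (simp add: C_def)
  qed
  show ?thesis
  proof (rule that)
    show "C > 0" using C1 by simp
    fix t x :: real
    assume t: "t > 0" "t\<^sup>2 \<ge> ln 2" and x: "x \<ge> 0"
    define q where "q = exp (t\<^sup>2)"
    show "2 * D * q\<^sup>2 * (x\<^sup>2 / (C * t\<^sup>2) - 1 / 2) \<le> cosh (t * max 0 (x - K))"
    proof (cases "x\<^sup>2 \<le> C * t\<^sup>2 / 2")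
      case True
      then have "x\<^sup>2 / (C * t\<^sup>2) - 1 / 2 \<le> 0" using C1 t by (simp add: field_simps)
      then have "2 * D * q\<^sup>2 * (x\<^sup>2 / (C * t\<^sup>2) - 1 / 2) \<le> 0"
        using D by (intro mult_nonneg_nonpos) auto
      then show ?thesis using cosh_real_nonneg order_trans by blast
    next
      case False
      define u where "u = x / t"
      have xu: "x = u * t" using t by (simp add: u_def)
      have "u0\<^sup>2 * t\<^sup>2 < u\<^sup>2 * t\<^sup>2" using False by (simp add: C_def xu power_mult_distrib)
      then have "u0\<^sup>2 < u\<^sup>2" using t by simp
      then have uu: "u0 < u" by (rule power_less_imp_less_base) (use x t in \<open>simp add: u_def\<close>)
      have "t \<ge> 1 / 2"
      proof -
        have "(1/2)\<^sup>2 \<le> t\<^sup>2" using t ln2_ge_two_thirds by (simp add: power2_eq_square)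
        then show ?thesis using t power2_le_imp_le[of "1/2" t] by simp
      qed
      then have "t * K \<le> (2 * t) * (t * K)"
        using mult_right_mono[of 1 "2 * t" "t * K"] t K by simp
      then have tK: "t\<^sup>2 * (u - 2 * K) \<le> t * (x - K)"
        by (simp add: xu algebra_simps power2_eq_square)
      have "2 * D * q\<^sup>2 * (x\<^sup>2 / (C * t\<^sup>2) - 1 / 2) \<le> 2 * D * q\<^sup>2 * (u\<^sup>2 / C)"
        using D t by (intro mult_left_mono) (auto simp: xu power_mult_distrib)
      also have "\<dots> \<le> 2 * D * q\<^sup>2 * (u\<^sup>2 / 1)"
        using D C1 by (intro mult_left_mono divide_left_mono) auto
      also have "\<dots> = q\<^sup>2 * (4 * D * u\<^sup>2) / 2" by simp
      also have "\<dots> \<le> q\<^sup>2 * exp (ln 2 * (u - 2 - 2 * K)) / 2"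
        using u1[of u] uu u0 by (intro divide_right_mono mult_left_mono) auto
      also have "\<dots> \<le> q\<^sup>2 * exp (t\<^sup>2 * (u - 2 - 2 * K)) / 2"
        using t uu u0 by (intro divide_right_mono mult_left_mono) (auto intro!: mult_right_mono)
      also have "\<dots> = exp (t\<^sup>2 * (u - 2 * K)) / 2"
        by (simp add: q_def power2_eq_square[of "exp _"] exp_add[symmetric] algebra_simps)
      also have "\<dots> \<le> exp (t * (x - K)) / 2" using tK by simp
      also have "\<dots> \<le> exp (t * max 0 (x - K)) / 2" using t by simp
      also have "\<dots> \<le> cosh (t * max 0 (x - K))" by (simp add: cosh_field_def)
      finally show ?thesis .
    qed
  qed
qed

lemma sparse_Cauchy_Schwarz:
  assumes S: "S \<subseteq> {1..p}" and vS: "(\<Sum>i\<in>S. (v i)\<^sup>2) \<le> p / 4"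
    and \<mu>: "\<And>i. i \<in> {1..p} - S \<Longrightarrow> \<mu> i = 0"
  shows "(dot p v \<mu>)\<^sup>2 \<le> p / 4 * dot p \<mu> \<mu>"
proof -
  have "dot p v \<mu> = (\<Sum>i\<in>S. v i * \<mu> i)"
    unfolding dot_def using S \<mu> by (intro sum.mono_neutral_right) auto
  then have "(dot p v \<mu>)\<^sup>2 \<le> (\<Sum>i\<in>S. (v i)\<^sup>2) * (\<Sum>i\<in>S. (\<mu> i)\<^sup>2)"
    using Cauchy_Schwarz_ineq_sum[of v \<mu> S] by simp
  also have "(\<Sum>i\<in>S. (\<mu> i)\<^sup>2) = dot p \<mu> \<mu>"
    unfolding dot_def power2_eq_square using S \<mu> by (intro sum.mono_neutral_left) auto
  also have "(\<Sum>i\<in>S. (v i)\<^sup>2) * dot p \<mu> \<mu> \<le> p / 4 * dot p \<mu> \<mu>"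
    using vS by (intro mult_right_mono dot_nonneg)
  finally show ?thesis .
qed

text \<open>
  Sparse means. Off the support \<open>S\<close> the data are noise moved along \<open>v\<close> by a random amount \<open>c\<close>;
  the quadratic term of the expansion of \<open>cosh\<close> absorbs the linear one whatever \<open>c\<close> is, at a cost of
  order \<open>exp (t\<^sup>2)\<^sup>2\<close>. On \<open>S\<close> the noise of each coordinate exceeds \<open>K\<close> with small probability only, so
  that by Markov's inequality for the weighted sum \<open>loss\<close> half of the total weight \<open>W\<close> survives. No
  variance of the statistic under the alternative enters: it can be too large for Chebyshev's
  inequality if few coordinates carry the signal.
\<close>

lemma cosh_stat_sparse:
  fixes s :: real
  assumes p: "p \<ge> 1" and v: "dot p v v = p" and K: "K > 0" and t: "t > 0" "t\<^sup>2 \<ge> ln 2"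
    and S: "S \<subseteq> {1..p}" "card S \<le> s" and vS: "(\<Sum>i\<in>S. (v i)\<^sup>2) \<le> p / 4"
    and s: "sqrt p \<le> s * exp (t\<^sup>2)"
    and \<mu>: "\<And>i. i \<in> {1..p} - S \<Longrightarrow> \<mu> i = 0"
    and C: "C > 0" "\<And>x. x \<ge> 0 \<Longrightarrow>
      2 * D * (exp (t\<^sup>2))\<^sup>2 * (x\<^sup>2 / (C * t\<^sup>2) - 1 / 2) \<le> cosh (t * max 0 (x - K))"
    and \<mu>\<mu>: "2 * C * s * t\<^sup>2 \<le> dot p \<mu> \<mu>"
    and D: "2 + 4 * K + 2 * K\<^sup>2 \<le> D" and s1: "s \<ge> 1"
  shows "measure (gauss p) {z \<in> space (Rp p).
      cosh_stat p v t (\<lambda>i. \<mu> i + z i) < p * exp (t\<^sup>2 / 2) + K * sqrt p * exp (t\<^sup>2)} \<le> 9 / K\<^sup>2"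
proof -
  interpret prob_space "gauss p" by (rule prob_space_gauss)
  define q where "q = exp (t\<^sup>2)"
  define e where "e = exp (t\<^sup>2 / 2)"
  define J where "J = {1..p} - S"
  define m where "m = proj p v \<mu>"
  define w where "w i = cosh (t * max 0 (\<bar>m i\<bar> - K))" for i
  define W where "W = (\<Sum>i\<in>S. w i)"
  have finS: "finite S" using S(1) finite_subset by blast
  have q1: "q \<ge> 1" by (simp add: q_def)
  have eq: "e \<le> q" "e \<ge> 0" by (auto simp: q_def e_def)
  have w1: "w i \<ge> 1" for i by (simp add: w_def cosh_real_ge_1)
  have vJ: "(\<Sum>i\<in>J. (v i)\<^sup>2) \<ge> 3 / 4 * p" "(\<Sum>i\<in>J. (v i)\<^sup>2) \<le> p"
  proof -
    have "(\<Sum>i\<in>J. (v i)\<^sup>2) = (\<Sum>i\<in>{1..p}. (v i)\<^sup>2) - (\<Sum>i\<in>S. (v i)\<^sup>2)"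
      unfolding J_def using S by (simp add: sum_diff)
    also have "(\<Sum>i\<in>{1..p}. (v i)\<^sup>2) = p" using v by (simp add: dot_def power2_eq_square)
    finally have *: "(\<Sum>i\<in>J. (v i)\<^sup>2) = p - (\<Sum>i\<in>S. (v i)\<^sup>2)" .
    then show "(\<Sum>i\<in>J. (v i)\<^sup>2) \<ge> 3 / 4 * p" using vS by simp
    show "(\<Sum>i\<in>J. (v i)\<^sup>2) \<le> p" unfolding * by (simp add: sum_nonneg)
  qed
  \<comment> \<open>Even restricted to the support, the projection keeps at least half of the squared norm of \<open>\<mu>\<close>.\<close>
  have mS: "C * s * t\<^sup>2 \<le> (\<Sum>i\<in>S. (m i)\<^sup>2)"
  proof -
    define k where "k = dot p v \<mu> / p"
    have 1: "(\<Sum>i\<in>S. v i * \<mu> i) = dot p v \<mu>" "(\<Sum>i\<in>S. (\<mu> i)\<^sup>2) = dot p \<mu> \<mu>"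
      unfolding dot_def power2_eq_square using S \<mu> by (auto intro!: sum.mono_neutral_left)
    have "(\<Sum>i\<in>S. (m i)\<^sup>2) = (\<Sum>i\<in>S. (\<mu> i)\<^sup>2 - 2 * k * (v i * \<mu> i) + k\<^sup>2 * (v i)\<^sup>2)"
      by (intro sum.cong refl) (simp add: m_def proj_def k_def[symmetric] power2_eq_square algebra_simps)
    also have "\<dots> = dot p \<mu> \<mu> - 2 * k * dot p v \<mu> + k\<^sup>2 * (\<Sum>i\<in>S. (v i)\<^sup>2)"
      by (simp add: sum.distrib sum_subtractf sum_distrib_left[symmetric] 1)
    also have "\<dots> \<ge> dot p \<mu> \<mu> - 2 * k * dot p v \<mu>" by (simp add: sum_nonneg)
    also have "2 * k * dot p v \<mu> = 2 * (dot p v \<mu>)\<^sup>2 / p" by (simp add: k_def power2_eq_square)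
    also have "dot p \<mu> \<mu> - 2 * (dot p v \<mu>)\<^sup>2 / p \<ge> dot p \<mu> \<mu> - dot p \<mu> \<mu> / 2"
      using sparse_Cauchy_Schwarz[OF S(1) vS \<mu>] p by (simp add: field_simps)
    finally show ?thesis using \<mu>\<mu> by simp
  qed
  have W: "D * s * q\<^sup>2 \<le> W"
  proof -
    have D0: "D > 0"
    proof -
      have "0 \<le> K\<^sup>2" by simp
      with D K show ?thesis by linarith
    qed
    have "s / 2 \<le> s - card S / 2" using S by simp
    also have "\<dots> \<le> (\<Sum>i\<in>S. (m i)\<^sup>2) / (C * t\<^sup>2) - card S / 2"
      using mS C(1) t by (simp add: field_simps)
    also have "\<dots> = (\<Sum>i\<in>S. \<bar>m i\<bar>\<^sup>2 / (C * t\<^sup>2) - 1 / 2)"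
      by (simp add: sum_subtractf sum_divide_distrib)
    finally have "2 * D * q\<^sup>2 * (s / 2) \<le> 2 * D * q\<^sup>2 * (\<Sum>i\<in>S. \<bar>m i\<bar>\<^sup>2 / (C * t\<^sup>2) - 1 / 2)"
      using D0 by (intro mult_left_mono) auto
    also have "\<dots> = (\<Sum>i\<in>S. 2 * D * q\<^sup>2 * (\<bar>m i\<bar>\<^sup>2 / (C * t\<^sup>2) - 1 / 2))"
      by (rule sum_distrib_left)
    also have "\<dots> \<le> W"
      unfolding W_def w_def q_def by (intro sum_mono C(2)) simp
    finally show ?thesis by (simp add: mult_ac)
  qed
  have W0: "0 < W"
  proof -
    have "0 \<le> K\<^sup>2" by simp
    then have "0 < D" using D K by linarith
    then have "0 < D * s * q\<^sup>2" using s1 q1 by simp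
    with W show ?thesis by simp
  qed
  \<comment> \<open>The weight of the coordinates of the support at which the noise is large.\<close>
  define loss where "loss z = (\<Sum>i\<in>S. w i * indicator {z \<in> space (Rp p). K < \<bar>proj p v z i\<bar>} z)" for z
  define A where "A z \<longleftrightarrow> (\<Sum>i\<in>J. cosh (t * z i)) < card J * exp (t\<^sup>2 / 2) - K * sqrt p * exp (t\<^sup>2)" for z
  define B where "B z \<longleftrightarrow> K\<^sup>2 * p * (exp (t\<^sup>2))\<^sup>2 \<le> (\<Sum>i\<in>J. v i * sinh (t * z i))\<^sup>2" for z
  have J: "J \<subseteq> {1..p}" by (auto simp: J_def)
  have pA: "measure (gauss p) {z \<in> space (Rp p). A z} \<le> 1 / (2 * K\<^sup>2)"
    unfolding A_def using K p J by (intro cosh_sum_lower_tail)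
  have pB: "measure (gauss p) {z \<in> space (Rp p). B z} \<le> 1 / (2 * K\<^sup>2)"
    unfolding B_def using K p vJ J by (intro sinh_sum_tail) auto
  have [measurable]: "(\<lambda>z. \<Sum>i\<in>J. cosh (t * z i)) \<in> borel_measurable (Rp p)"
    "(\<lambda>z. \<Sum>i\<in>J. v i * sinh (t * z i)) \<in> borel_measurable (Rp p)"
    by (intro measurable_coord_sum J; simp)+
  have set_i: "{z \<in> space (Rp p). K < \<bar>proj p v z i\<bar>} \<in> sets (Rp p)" if "i \<in> S" for i
  proof -
    have "i \<in> {1..p}" using S that by auto
    note measurable_proj[OF this, measurable]
    show ?thesis by measurable
  qed
  have int: "integrable (gauss p) (\<lambda>z. w i * indicator {z \<in> space (Rp p). K < \<bar>proj p v z i\<bar>} z)"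
    if "i \<in> S" for i
    using set_i[OF that] by (intro integrable_mult_right integrable_real_indicator) (auto simp: sets_gauss less_top[symmetric])
  have intL: "integrable (gauss p) loss"
    unfolding loss_def by (intro Bochner_Integration.integrable_sum int)
  have pL: "measure (gauss p) {z \<in> space (Rp p). W / 2 < loss z} \<le> 8 / K\<^sup>2"
  proof (rule gauss_tail[OF intL])
    show "0 \<le> loss z" for z
      unfolding loss_def using w1 by (intro sum_nonneg mult_nonneg_nonneg) (auto intro: order_trans[OF zero_le_one])
    show "0 < W / 2" using W0 by simp
    have "(\<integral>z. loss z \<partial>gauss p) = (\<Sum>i\<in>S. w i * measure (gauss p) {z \<in> space (Rp p). K < \<bar>proj p v z i\<bar>})"
      unfolding loss_def
      by (subst Bochner_Integration.integral_sum, erule int)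
         (use set_i in \<open>auto simp: space_gauss intro!: sum.cong arg_cong[where f = "measure (gauss p)"]\<close>)
    also have "\<dots> \<le> (\<Sum>i\<in>S. w i * (4 / K\<^sup>2))"
    proof (intro sum_mono mult_left_mono)
      fix i assume i: "i \<in> S"
      then have ip: "i \<in> {1..p}" using S by auto
      define l where "l j = unit i j - v i / p * v j" for j
      have "dot p l z = proj p v z i" for z
        unfolding l_def dot_linear using ip by (simp add: dot_unit proj_def)
      moreover have "dot p l l = 1 - (v i)\<^sup>2 / p"
        unfolding l_def dot_linear using ip p
        by (simp add: dot_unit dot_unit_right v field_simps power2_eq_square) (simp add: unit_def)
      then have "dot p l l \<le> 1" by simp
      ultimately show "measure (gauss p) {z \<in> space (Rp p). K < \<bar>proj p v z i\<bar>} \<le> 4 / K\<^sup>2"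
        using dot_tail[OF _ K, of p l] by simp
      show "0 \<le> w i" using w1[of i] by simp
    qed
    also have "\<dots> = W / 2 * (8 / K\<^sup>2)" unfolding sum_distrib_right[symmetric] W_def by simp
    finally show "(\<integral>z. loss z \<partial>gauss p) \<le> W / 2 * (8 / K\<^sup>2)" .
  qed auto
  have mA: "{z \<in> space (Rp p). A z} \<in> sets (Rp p)" and mB: "{z \<in> space (Rp p). B z} \<in> sets (Rp p)"
    unfolding A_def B_def by measurable
  note [measurable] = borel_measurable_integrable[OF intL]
  have mL: "{z \<in> space (Rp p). W / 2 < loss z} \<in> sets (Rp p)"
    by measurable
  have pAB: "measure (gauss p) {z \<in> space (Rp p). A z \<or> B z} \<le> 1 / (2 * K\<^sup>2) + 1 / (2 * K\<^sup>2)"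
    by (rule gauss_Collect_Un[OF pA mA pB mB])
  have mAB: "{z \<in> space (Rp p). A z \<or> B z} \<in> sets (Rp p)"
    using mA mB unfolding A_def B_def by measurable
  have "measure (gauss p) {z \<in> space (Rp p). cosh_stat p v t (\<lambda>i. \<mu> i + z i)
      < p * exp (t\<^sup>2 / 2) + K * sqrt p * exp (t\<^sup>2)} \<le> (1 / (2 * K\<^sup>2) + 1 / (2 * K\<^sup>2)) + 8 / K\<^sup>2"
  proof (rule gauss_Collect_Un[OF pAB mAB pL mL], rule ccontr)
    fix z assume zs: "z \<in> space (Rp p)"
      and z: "cosh_stat p v t (\<lambda>i. \<mu> i + z i) < p * exp (t\<^sup>2 / 2) + K * sqrt p * exp (t\<^sup>2)"
      and neg: "\<not> ((A z \<or> B z) \<or> W / 2 < loss z)"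
    define U where "U = (\<Sum>i\<in>J. v i * sinh (t * z i))"
    define c where "c = t * (dot p v (\<lambda>i. \<mu> i + z i) / p)"
    have U: "U\<^sup>2 < K\<^sup>2 * p * q\<^sup>2" using neg by (simp add: B_def U_def q_def)
    have onS: "W / 2 \<le> (\<Sum>i\<in>S. cosh (t * proj p v (\<lambda>i. \<mu> i + z i) i))"
    proof -
      have "W / 2 \<le> W - loss z" using neg by simp
      also have "\<dots> = (\<Sum>i\<in>S. w i - w i * indicator {z \<in> space (Rp p). K < \<bar>proj p v z i\<bar>} z)"
        by (simp add: W_def loss_def sum_subtractf)
      also have "\<dots> \<le> (\<Sum>i\<in>S. cosh (t * proj p v (\<lambda>i. \<mu> i + z i) i))"
      proof (rule sum_mono)
        fix i assume "i \<in> S"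
        show "w i - w i * indicator {z \<in> space (Rp p). K < \<bar>proj p v z i\<bar>} z
            \<le> cosh (t * proj p v (\<lambda>i. \<mu> i + z i) i)"
        proof (cases "K < \<bar>proj p v z i\<bar>")
          case False
          then have "\<bar>m i\<bar> - K \<le> \<bar>m i + proj p v z i\<bar>" by linarith
          then have "t * max 0 (\<bar>m i\<bar> - K) \<le> \<bar>t * (m i + proj p v z i)\<bar>"
            using t by (auto simp: abs_mult)
          then have "w i \<le> cosh \<bar>t * (m i + proj p v z i)\<bar>"
            unfolding w_def using t by (subst cosh_real_nonneg_le_iff) auto
          then show ?thesis using False by (simp add: proj_add m_def)
        qed (use zs in simp)
      qed
      finally show ?thesis .
    qed
    have "(\<Sum>i\<in>J. cosh (t * proj p v (\<lambda>i. \<mu> i + z i) i)) = (\<Sum>i\<in>J. cosh (t * z i + (- c * v i)))"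
      by (intro sum.cong refl) (simp add: proj_def c_def J_def \<mu> algebra_simps)
    also have "\<dots> \<ge> (\<Sum>i\<in>J. cosh (t * z i) + (- c * v i) * sinh (t * z i) + (- c * v i)\<^sup>2 / 2)"
      by (intro sum_mono cosh_Taylor)
    also have "(\<Sum>i\<in>J. cosh (t * z i) + (- c * v i) * sinh (t * z i) + (- c * v i)\<^sup>2 / 2)
        = (\<Sum>i\<in>J. cosh (t * z i)) - c * U + c\<^sup>2 / 2 * (\<Sum>i\<in>J. (v i)\<^sup>2)"
      unfolding U_def
      by (simp add: sum.distrib sum_distrib_left sum_subtractf sum_negf algebra_simps power_mult_distrib)
    finally have offS: "(\<Sum>i\<in>J. cosh (t * z i)) - c * U + c\<^sup>2 / 2 * (\<Sum>i\<in>J. (v i)\<^sup>2)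
      \<le> (\<Sum>i\<in>J. cosh (t * proj p v (\<lambda>i. \<mu> i + z i) i))" .
    have 1: "- (K\<^sup>2 * q\<^sup>2) \<le> - c * U + c\<^sup>2 / 2 * (\<Sum>i\<in>J. (v i)\<^sup>2)"
    proof -
      \<comment> \<open>The quadratic in \<open>c\<close> is bounded below by completing the square.\<close>
      define X where "X = - c * U + c\<^sup>2 / 2 * (\<Sum>i\<in>J. (v i)\<^sup>2)"
      have "c\<^sup>2 / 2 * (3 / 4 * p) \<le> c\<^sup>2 / 2 * (\<Sum>i\<in>J. (v i)\<^sup>2)"
        by (rule mult_left_mono[OF vJ(1)]) simp
      then have "- c * U + c\<^sup>2 / 2 * (3 / 4 * p) \<le> X" unfolding X_def by (rule add_left_mono)
      then have pX: "p * (- c * U + c\<^sup>2 / 2 * (3 / 4 * p)) \<le> p * X" by (rule mult_left_mono) simp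
      have "0 \<le> (3 * c * p - 4 * U)\<^sup>2" by simp
      also have "\<dots> = 24 * (p * (- c * U + c\<^sup>2 / 2 * (3 / 4 * p))) + 16 * U\<^sup>2"
        by (simp add: power2_eq_square algebra_simps)
      also have "\<dots> \<le> 24 * (p * X) + 24 * U\<^sup>2"
        by (rule add_mono[OF mult_left_mono[OF pX]]) simp_all
      finally have "p * (- (K\<^sup>2 * q\<^sup>2)) \<le> p * X"
        using U by (simp add: mult_ac)
      then show ?thesis unfolding X_def[symmetric] using p by (subst (asm) mult_le_cancel_left_pos) auto
    qed
    have 2: "p * e - s * q - K * sqrt p * q \<le> (\<Sum>i\<in>J. cosh (t * z i))"
    proof -
      have "card J = real p - card S"
        unfolding J_def using S by (simp add: card_Diff_subset[OF finS] card_mono[OF _ S(1), simplified] of_nat_diff)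
      then have "p * e - card S * e = card J * e" by (simp add: left_diff_distrib)
      moreover have "card J * e - K * sqrt p * q \<le> (\<Sum>i\<in>J. cosh (t * z i))"
        using neg by (simp add: A_def e_def q_def)
      moreover have "card S * e \<le> s * q" using S eq by (intro mult_mono) auto
      ultimately show ?thesis by simp
    qed
    have split: "cosh_stat p v t (\<lambda>i. \<mu> i + z i) = (\<Sum>i\<in>S. cosh (t * proj p v (\<lambda>i. \<mu> i + z i) i))
        + (\<Sum>i\<in>J. cosh (t * proj p v (\<lambda>i. \<mu> i + z i) i))"
      unfolding cosh_stat_def J_def by (subst sum.subset_diff[OF S(1)]) (simp_all add: add.commute)
    have 3: "s * q \<le> s * q\<^sup>2" using q1 s1 by (simp add: power2_eq_square)
    have 4: "2 * K * (sqrt p * q) \<le> 2 * K * (s * q\<^sup>2)"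
      using mult_right_mono[OF s, of q] q1 K by (simp add: q_def power2_eq_square mult_ac)
    have 5: "K\<^sup>2 * q\<^sup>2 \<le> K\<^sup>2 * (s * q\<^sup>2)"
      using mult_right_mono[OF s1, of "q\<^sup>2"] by (intro mult_left_mono) simp_all
    have 6: "(1 + 2 * K + K\<^sup>2) * (s * q\<^sup>2) \<le> W / 2"
    proof -
      have "(2 + 4 * K + 2 * K\<^sup>2) * (s * q\<^sup>2) \<le> D * (s * q\<^sup>2)"
        using D s1 by (intro mult_right_mono) auto
      with W show ?thesis by (simp add: algebra_simps)
    qed
    have "p * e + K * sqrt p * q \<le> cosh_stat p v t (\<lambda>i. \<mu> i + z i)"
      using onS offS 1 2 3 4 5 6 unfolding split by (simp add: algebra_simps)
    with z show False by (simp add: q_def e_def)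
  qed
  then show ?thesis using K by (simp add: field_simps)
qed

section \<open>Observations and risk\<close>

text \<open>
  The linear image of a noise vector \<open>z\<close> that realises the observation. The choice of \<open>a\<close> and \<open>b\<close> that
  gives the covariance \<open>(1 - \<gamma>) I + \<gamma> v v\<^sup>T\<close> is \<open>sqrt (1 - \<gamma>)\<close> and the coefficient defined next.
\<close>

definition obs ::
  "nat \<Rightarrow> (nat \<Rightarrow> real) \<Rightarrow> real \<Rightarrow> real \<Rightarrow> (nat \<Rightarrow> real) \<Rightarrow> (nat \<Rightarrow> real) \<Rightarrow> nat \<Rightarrow> real" where
  "obs p \<theta> a b v z = (\<lambda>i\<in>{1..p}. \<theta> i + (a * z i + b * dot p v z * v i))"

text \<open>
The coefficient of \<open>v v\<^sup>T\<close> in the positive semidefinite root of the spiked covariance.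
\<close>

definition spike_coeff :: "nat \<Rightarrow> real \<Rightarrow> real" where
  "spike_coeff p \<gamma> = (sqrt (1 - \<gamma> + \<gamma> * p) - sqrt (1 - \<gamma>)) / p"

lemma measurable_obs [measurable]: "obs p \<theta> a b v \<in> measurable (Rp p) (Rp p)"
  unfolding obs_def[abs_def]
  by (subst (2) Rp_def, rule measurable_restrict)
     (use measurable_component_Rp in measurable)

text \<open>
  By uniqueness of the positive semidefinite root, the choice operator in the definition of the
  normal law may be replaced by the explicit root of the spiked covariance.
\<close>

lemma obs_law_eq:
  assumes v: "L2_set v {1..p} = sqrt (real p)" and \<gamma>: "0 \<le> \<gamma>" "\<gamma> \<le> 1" and p: "p \<ge> 1"
  shows "obs_law p \<theta> \<gamma> v = distr (gauss p) (Rp p) (obs p \<theta> (sqrt (1 - \<gamma>)) (spike_coeff p \<gamma>) v)"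
proof -
  let ?a = "sqrt (1 - \<gamma>)" and ?b = "spike_coeff p \<gamma>"
  let ?A = "\<lambda>i j. ?a * (if i = j then 1 else 0) + ?b * (v i * v j)"
  have root: "psd_root p (spiked_cov \<gamma> v) ?A"
    using psd_root_spiked_cov[OF v \<gamma> p] by (simp add: spike_coeff_def)
  then have root': "psd_root p (spiked_cov \<gamma> v) (mat_sqrt p (spiked_cov \<gamma> v))"
    unfolding mat_sqrt_def by (rule someI[where P = "psd_root p (spiked_cov \<gamma> v)"])
  have "(\<Sum>j=1..p. mat_sqrt p (spiked_cov \<gamma> v) i j * z j) = ?a * z i + ?b * dot p v z * v i"
    if i: "i \<in> {1..p}" for i z
  proof -
    have "(\<Sum>j=1..p. mat_sqrt p (spiked_cov \<gamma> v) i j * z j) = (\<Sum>j=1..p. ?A i j * z j)"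
      using psd_root_unique[OF root' root i] by (intro sum.cong refl) simp
    also have "\<dots> = (\<Sum>j=1..p. (if i = j then ?a * z j else 0) + ?b * v i * (v j * z j))"
      by (intro sum.cong refl) (simp add: algebra_simps)
    also have "\<dots> = ?a * z i + ?b * v i * dot p v z"
      using i by (simp add: sum.distrib dot_def sum_distrib_left)
    finally show ?thesis by simp
  qed
  then have "(\<lambda>z. \<lambda>i\<in>{1..p}. \<theta> i + (\<Sum>j=1..p. mat_sqrt p (spiked_cov \<gamma> v) i j * z j))
      = obs p \<theta> ?a ?b v"
    by (intro ext) (simp add: obs_def restrict_def)
  then show ?thesis by (simp add: obs_law_def mvn_def gauss_def)
qed

lemma measure_obs_law:
  assumes v: "L2_set v {1..p} = sqrt (real p)" and \<gamma>: "0 \<le> \<gamma>" "\<gamma> \<le> 1" and p: "p \<ge> 1"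
    and A: "{x \<in> space (Rp p). P x} \<in> sets (Rp p)"
  shows "measure (obs_law p \<theta> \<gamma> v) {x \<in> space (Rp p). P x}
    = measure (gauss p) {z \<in> space (Rp p). P (obs p \<theta> (sqrt (1 - \<gamma>)) (spike_coeff p \<gamma>) v z)}"
proof -
  have o: "obs p \<theta> (sqrt (1 - \<gamma>)) (spike_coeff p \<gamma>) v \<in> measurable (gauss p) (Rp p)"
    by measurable
  have "obs p \<theta> a b v z \<in> space (Rp p)" for a b z
    by (auto simp: obs_def Rp_def space_PiM)
  then show ?thesis
    unfolding obs_law_eq[OF v \<gamma> p] measure_distr[OF o A]
    by (intro arg_cong[where f = "measure (gauss p)"]) (auto simp: space_gauss)
qed

lemma prob_space_obs_law:
  assumes "L2_set v {1..p} = sqrt (real p)" "0 \<le> \<gamma>" "\<gamma> \<le> 1" "p \<ge> 1"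
  shows "prob_space (obs_law p \<theta> \<gamma> v)"
  unfolding obs_law_eq[OF assms] by (intro prob_space.prob_space_distr prob_space_gauss) measurable

lemma sets_test:
  assumes "\<phi> \<in> tests p"
  shows "{x \<in> space (Rp p). \<phi> x = k} \<in> sets (Rp p)"
proof -
  have \<phi>: "\<phi> \<in> measurable (Rp p) (count_space {0, 1})" using assms by (simp add: tests_def)
  have "{x \<in> space (Rp p). \<phi> x = k} = \<phi> -` ({k} \<inter> {0, 1}) \<inter> space (Rp p)"
    using measurable_space[OF \<phi>] by auto
  also have "\<dots> \<in> sets (Rp p)" by (rule measurable_sets[OF \<phi>]) simp
  finally show ?thesis .
qed

lemma test_of_pred:
  assumes "{x \<in> space (Rp p). P x} \<in> sets (Rp p)"
  shows "(\<lambda>x. if P x then 1 else 0) \<in> tests p"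
  unfolding tests_def by (rule measurable_If) (use assms in auto)

lemma Theta_nonempty:
  assumes "p \<ge> 1" "s \<ge> 1"
  shows "Theta p s \<epsilon> \<noteq> {}"
proof -
  define \<theta> where "\<theta> = (\<lambda>i\<in>{1..p}. if i = 1 then \<epsilon> else 0)"
  have "L2_set \<theta> {1..p} = \<bar>\<epsilon>\<bar>"
  proof -
    have "(\<Sum>i=1..p. (\<theta> i)\<^sup>2) = (\<Sum>i\<in>{1..p}. if i = 1 then \<epsilon>\<^sup>2 else 0)"
      by (intro sum.cong refl) (auto simp: \<theta>_def)
    also have "\<dots> = \<epsilon>\<^sup>2" using assms by simp
    finally show ?thesis by (simp add: L2_set_def)
  qed
  moreover have "norm0 p \<theta> \<le> card {1::nat}"
    unfolding norm0_def by (intro card_mono) (auto simp: \<theta>_def split: if_splits)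
  ultimately have "\<theta> \<in> Theta p s \<epsilon>"
    using assms by (auto simp: Theta_def \<theta>_def Rp_def space_PiM)
  then show ?thesis by blast
qed

lemma bdd_above_type_II:
  assumes "L2_set v {1..p} = sqrt (real p)" "0 \<le> \<gamma>" "\<gamma> \<le> 1" "p \<ge> 1"
  shows "bdd_above ((\<lambda>\<theta>. measure (obs_law p \<theta> \<gamma> v) (A \<theta>)) ` T)"
  using prob_space.prob_le_1[OF prob_space_obs_law[OF assms]] by (intro bdd_aboveI2)

lemma risk_terms_nonneg:
  assumes vp: "L2_set v {1..p} = sqrt (real p)" "0 \<le> \<gamma>" "\<gamma> \<le> 1" "p \<ge> 1" and s: "s \<ge> 1"
  shows "0 \<le> measure (obs_law p (\<lambda>i\<in>{1..p}. 0) \<gamma> v) {x \<in> space (Rp p). \<phi> x = 1} +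
        (SUP \<theta> \<in> Theta p s \<epsilon>. measure (obs_law p \<theta> \<gamma> v) {x \<in> space (Rp p). \<phi> x = 0})"
proof -
  obtain \<theta> where "\<theta> \<in> Theta p s \<epsilon>" using Theta_nonempty vp s by blast
  then have "0 \<le> (SUP \<theta> \<in> Theta p s \<epsilon>. measure (obs_law p \<theta> \<gamma> v) {x \<in> space (Rp p). \<phi> x = 0})"
    by (intro cSUP_upper2[where x = \<theta>] bdd_above_type_II vp) auto
  then show ?thesis by simp
qed

lemma risk_le:
  assumes vp: "L2_set v {1..p} = sqrt (real p)" "0 \<le> \<gamma>" "\<gamma> \<le> 1" "p \<ge> 1" and s: "s \<ge> 1"
    and \<phi>: "\<phi> \<in> tests p"
    and 0: "measure (obs_law p (\<lambda>i\<in>{1..p}. 0) \<gamma> v) {x \<in> space (Rp p). \<phi> x = 1} \<le> \<alpha>"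
    and 1: "\<And>\<theta>. \<theta> \<in> Theta p s \<epsilon> \<Longrightarrow> measure (obs_law p \<theta> \<gamma> v) {x \<in> space (Rp p). \<phi> x = 0} \<le> \<beta>"
  shows "risk p s \<gamma> v \<epsilon> \<le> \<alpha> + \<beta>"
proof -
  have "risk p s \<gamma> v \<epsilon> \<le> measure (obs_law p (\<lambda>i\<in>{1..p}. 0) \<gamma> v) {x \<in> space (Rp p). \<phi> x = 1} +
        (SUP \<theta> \<in> Theta p s \<epsilon>. measure (obs_law p \<theta> \<gamma> v) {x \<in> space (Rp p). \<phi> x = 0})"
    unfolding risk_def
    by (rule cINF_lower[OF _ \<phi>]) (intro bdd_belowI2[where m = 0] risk_terms_nonneg vp s)
  also have "\<dots> \<le> \<alpha> + \<beta>"
    using Theta_nonempty[OF vp(4) s] by (intro add_mono 0 cSUP_least 1)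
  finally show ?thesis .
qed

lemma risk_ge:
  assumes "\<And>\<phi>. \<phi> \<in> tests p \<Longrightarrow> r \<le> measure (obs_law p (\<lambda>i\<in>{1..p}. 0) \<gamma> v) {x \<in> space (Rp p). \<phi> x = 1} +
        (SUP \<theta> \<in> Theta p s \<epsilon>. measure (obs_law p \<theta> \<gamma> v) {x \<in> space (Rp p). \<phi> x = 0})"
  shows "r \<le> risk p s \<gamma> v \<epsilon>"
proof -
  have "(\<lambda>_. 0) \<in> tests p" by (simp add: tests_def)
  then show ?thesis unfolding risk_def by (intro cINF_greatest assms) auto
qed

lemma risk_nonneg:
  assumes "L2_set v {1..p} = sqrt (real p)" "0 \<le> \<gamma>" "\<gamma> \<le> 1" "p \<ge> 1" "s \<ge> 1"
  shows "0 \<le> risk p s \<gamma> v \<epsilon>"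
  by (rule risk_ge) (rule risk_terms_nonneg[OF assms])

lemma dot_cong: "(\<And>i. i \<in> {1..p} \<Longrightarrow> x i = x' i) \<Longrightarrow> (\<And>i. i \<in> {1..p} \<Longrightarrow> y i = y' i)
    \<Longrightarrow> dot p x y = dot p x' y'"
  unfolding dot_def by (intro sum.cong) auto

lemma proj_cong: "(\<And>i. i \<in> {1..p} \<Longrightarrow> x i = x' i) \<Longrightarrow> i \<in> {1..p} \<Longrightarrow> proj p v x i = proj p v x' i"
  unfolding proj_def using dot_cong[of p v v x x'] by simp

lemma cosh_stat_cong: "(\<And>i. i \<in> {1..p} \<Longrightarrow> x i = x' i) \<Longrightarrow> cosh_stat p v t x = cosh_stat p v t x'"
  unfolding cosh_stat_def using proj_cong[of p x x'] by (intro sum.cong) auto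

lemma dot_obs:
  "dot p v (obs p \<theta> a b v z) = dot p v \<theta> + (a * dot p v z + b * dot p v z * dot p v v)"
proof -
  have "dot p v (obs p \<theta> a b v z) = dot p v (\<lambda>i. \<theta> i + (a * z i + b * dot p v z * v i))"
    by (intro dot_cong) (auto simp: obs_def)
  then show ?thesis unfolding dot_linear .
qed

text \<open>
The statistic of the observation depends neither on \<open>b\<close> nor on the noise along \<open>v\<close>.
\<close>

lemma cosh_stat_obs:
  assumes p: "p \<ge> 1" and v: "dot p v v = p" and a: "a > 0"
  shows "cosh_stat p v (t / a) (obs p \<theta> a b v z) = cosh_stat p v t (\<lambda>i. \<theta> i / a + z i)"
  unfolding cosh_stat_def
proof (intro sum.cong refl)
  fix i assume i: "i \<in> {1..p}"
  define \<mu> where "\<mu> i = \<theta> i / a" for i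
  have \<theta>: "\<theta> = (\<lambda>i. a * \<mu> i)" using a by (auto simp: \<mu>_def)
  have "(dot p v \<theta> + (a * dot p v z + b * dot p v z * p)) / p = a * ((dot p v \<mu> + dot p v z) / p) + b * dot p v z"
    unfolding \<theta> dot_linear using p by (simp add: add_divide_distrib algebra_simps)
  then have "proj p v (obs p \<theta> a b v z) i = a * (\<mu> i + z i - (dot p v \<mu> + dot p v z) / p * v i)"
    unfolding proj_def dot_obs v using i by (simp add: obs_def \<theta> algebra_simps)
  then have "t / a * proj p v (obs p \<theta> a b v z) i = t * proj p v (\<lambda>i. \<theta> i / a + z i) i"
    unfolding \<mu>_def[symmetric] using a by (simp add: proj_def dot_linear)
  then show "cosh (t / a * proj p v (obs p \<theta> a b v z) i) = cosh (t * proj p v (\<lambda>i. \<theta> i / a + z i) i)"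
    by (rule arg_cong)
qed

lemma L2_set_eq_sqrt_dot: "L2_set x {1..p} = sqrt (dot p x x)"
  using L2_set_dot[of x p] by (metis L2_set_nonneg real_sqrt_unique)

lemma risk_cosh_test:
  assumes vp: "L2_set v {1..p} = sqrt (real p)" "0 \<le> \<gamma>" "\<gamma> < 1" "p \<ge> 1" and s: "s \<ge> 1" and K: "K > 0"
    and alt: "\<And>\<theta>. \<theta> \<in> Theta p s \<epsilon> \<Longrightarrow> measure (gauss p) {z \<in> space (Rp p).
      cosh_stat p v t (\<lambda>i. \<theta> i / sqrt (1 - \<gamma>) + z i) < p * exp (t\<^sup>2 / 2) + K * sqrt p * exp (t\<^sup>2)} \<le> \<beta>"
  shows "risk p s \<gamma> v \<epsilon> \<le> 1 / K\<^sup>2 + \<beta>"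
proof -
  define a where "a = sqrt (1 - \<gamma>)"
  have a: "a > 0" using vp by (simp add: a_def)
  have vp': "\<gamma> \<le> 1" using vp by simp
  have v: "dot p v v = p" unfolding L2_set_dot[symmetric] vp(1) by simp
  define h where "h = p * exp (t\<^sup>2 / 2) + K * sqrt p * exp (t\<^sup>2)"
  define \<phi> :: "(nat \<Rightarrow> real) \<Rightarrow> nat" where "\<phi> x = (if h \<le> cosh_stat p v (t / a) x then 1 else 0)" for x
  show ?thesis
  proof (rule risk_le[OF vp(1,2) vp' vp(4) s])
    show \<phi>: "\<phi> \<in> tests p"
      unfolding \<phi>_def[abs_def] by (rule test_of_pred) measurable
    have "measure (obs_law p (\<lambda>i\<in>{1..p}. 0) \<gamma> v) {x \<in> space (Rp p). \<phi> x = 1}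
      = measure (gauss p) {z \<in> space (Rp p). h \<le> cosh_stat p v t (\<lambda>i. (\<lambda>i\<in>{1..p}. 0) i / a + z i)}"
      unfolding measure_obs_law[OF vp(1,2) vp' vp(4) sets_test[OF \<phi>]]
      by (intro arg_cong[where f = "measure (gauss p)"])
         (auto simp: \<phi>_def cosh_stat_obs[OF vp(4) v a] a_def[symmetric])
    also have "\<dots> = measure (gauss p) {z \<in> space (Rp p). h \<le> cosh_stat p v t z}"
    proof -
      have "cosh_stat p v t (\<lambda>i. (\<lambda>i\<in>{1..p}. 0) i / a + z i) = cosh_stat p v t z" for z
        by (rule cosh_stat_cong) auto
      then show ?thesis by (simp only:)
    qed
    also have "\<dots> \<le> 1 / K\<^sup>2"
      unfolding h_def by (rule cosh_stat_null[OF vp(4) v K])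
    finally show "measure (obs_law p (\<lambda>i\<in>{1..p}. 0) \<gamma> v) {x \<in> space (Rp p). \<phi> x = 1} \<le> 1 / K\<^sup>2" .
    fix \<theta> assume \<theta>: "\<theta> \<in> Theta p s \<epsilon>"
    have "measure (obs_law p \<theta> \<gamma> v) {x \<in> space (Rp p). \<phi> x = 0}
      = measure (gauss p) {z \<in> space (Rp p). cosh_stat p v t (\<lambda>i. \<theta> i / a + z i) < h}"
      unfolding measure_obs_law[OF vp(1,2) vp' vp(4) sets_test[OF \<phi>]]
      by (intro arg_cong[where f = "measure (gauss p)"])
         (auto simp: \<phi>_def cosh_stat_obs[OF vp(4) v a] a_def[symmetric])
    also have "\<dots> \<le> \<beta>" using alt[OF \<theta>] by (simp add: h_def a_def)
    finally show "measure (obs_law p \<theta> \<gamma> v) {x \<in> space (Rp p). \<phi> x = 0} \<le> \<beta>" .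
  qed
qed

section \<open>Upper bound and degenerate case\<close>

text \<open>
  The squared rate without its factor \<open>1 - \<gamma>\<close>. Under \<open>s \<le> omega p v\<close>
  the rate takes this form whatever the value of \<open>omega p v\<close>: if \<open>omega p v < sqrt p\<close>
  then \<open>s < sqrt p\<close>.
\<close>

definition sq_rate :: "nat \<Rightarrow> nat \<Rightarrow> real" where
  "sq_rate p s = (if real s \<le> sqrt p then s * ln (1 + p / (real s)\<^sup>2) else sqrt p)"

lemma sq_rate_pos: "p \<ge> 1 \<Longrightarrow> s \<ge> 1 \<Longrightarrow> 0 < sq_rate p s"
  unfolding sq_rate_def by (auto intro!: mult_pos_pos ln_gt_zero)

lemma Theta_support:
  assumes "\<theta> \<in> Theta p s \<epsilon>" "\<epsilon> \<ge> 0"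
  defines "S \<equiv> {i \<in> {1..p}. \<theta> i \<noteq> 0}"
  shows "S \<subseteq> {1..p}" "card S \<le> s" "\<And>i. i \<in> {1..p} - S \<Longrightarrow> \<theta> i = 0" "\<epsilon>\<^sup>2 \<le> dot p \<theta> \<theta>"
  using assms by (auto simp: Theta_def norm0_def L2_set_dot[symmetric] intro: power_mono)

lemma omega_bound:
  assumes s: "1 \<le> s" "s \<le> omega p v"
  shows "p \<ge> 1" and "\<And>S. S \<subseteq> {1..p} \<Longrightarrow> card S \<le> s \<Longrightarrow> (\<Sum>i\<in>S. (v i)\<^sup>2) \<le> p / 4"
proof -
  define F where "F s = {S. S \<subseteq> {1..p} \<and> card S \<le> s}" for s
  define g where "g S = (L2_set (restr v S) {1..p})\<^sup>2" for S
  define X where "X = {s. s \<le> p \<and> Max (g ` F s) \<le> real p / 4}"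
  have om: "omega p v = Max X" by (simp add: omega_def X_def F_def g_def)
  have finF: "finite (F s)" for s by (simp add: F_def)
  have g: "g S = (\<Sum>i\<in>S. (v i)\<^sup>2)" if "S \<subseteq> {1..p}" for S
  proof -
    have "g S = (\<Sum>i=1..p. (restr v S i)\<^sup>2)" unfolding g_def L2_set_def by (simp add: sum_nonneg)
    also have "\<dots> = (\<Sum>i\<in>S. (v i)\<^sup>2)"
      using that by (intro sum.mono_neutral_cong_right) (auto simp: restr_def)
    finally show ?thesis .
  qed
  have "F 0 = {{}}" unfolding F_def by (auto dest: finite_subset)
  then have "0 \<in> X" using g[of "{}"] by (simp add: X_def)
  moreover have "finite X" by (simp add: X_def)
  ultimately have X: "omega p v \<in> X" unfolding om by (intro Max_in) auto
  then show "p \<ge> 1" using s by (simp add: X_def)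
  fix S assume S: "S \<subseteq> {1..p}" "card S \<le> s"
  then have "S \<in> F (omega p v)" using s by (simp add: F_def)
  then have "g S \<le> Max (g ` F (omega p v))" using finF by (intro Max_ge) auto
  also have "\<dots> \<le> p / 4" using X by (simp add: X_def)
  finally show "(\<Sum>i\<in>S. (v i)\<^sup>2) \<le> p / 4" by (simp add: g[OF S(1)])
qed

text \<open>
  For \<open>s \<le> sqrt p\<close> the parameter is \<open>t\<^sup>2 = ln (1 + p / s\<^sup>2)\<close>, which balances the fluctuation
  \<open>sqrt p * exp (t\<^sup>2)\<close> of the statistic against the contribution of \<open>s\<close> coordinates of size of order \<open>t\<close>.
\<close>

lemma risk_upper:
  fixes \<eta> :: real
  assumes \<eta>: "0 < \<eta>" "\<eta> < 1"
  obtains C where "C > 0"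
    "\<And>p s \<gamma> v \<epsilon>. L2_set v {1..p} = sqrt (real p) \<Longrightarrow> 1 \<le> s \<Longrightarrow> s \<le> omega p v \<Longrightarrow>
      0 \<le> \<gamma> \<Longrightarrow> \<gamma> < 1 \<Longrightarrow> 0 \<le> \<epsilon> \<Longrightarrow> C * ((1 - \<gamma>) * sq_rate p s) \<le> \<epsilon>\<^sup>2 \<Longrightarrow> risk p s \<gamma> v \<epsilon> \<le> \<eta>"
proof -
  define K where "K = sqrt (10 / \<eta>)"
  have K2: "K\<^sup>2 = 10 / \<eta>" using \<eta> by (simp add: K_def)
  have K1: "K \<ge> 1" using \<eta> by (simp add: K_def)
  have \<eta>K: "1 / K\<^sup>2 + 9 / K\<^sup>2 = \<eta>" using \<eta> unfolding K2 by (simp add: field_simps)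
  define D where "D = 2 + 4 * K + 2 * K\<^sup>2"
  have D: "D > 0" using K1 by (simp add: D_def add_pos_nonneg)
  obtain C1 where C1: "C1 > 0" "\<And>t x. t > 0 \<Longrightarrow> t\<^sup>2 \<ge> ln 2 \<Longrightarrow> x \<ge> 0 \<Longrightarrow>
      2 * D * (exp (t\<^sup>2))\<^sup>2 * (x\<^sup>2 / (C1 * t\<^sup>2) - 1 / 2) \<le> cosh (t * max 0 (x - K))"
    using cosh_growth[of K D] K1 D by auto
  define C2 where "C2 = 256 * K\<^sup>2 + 32 * K"
  have C2: "C2 > 0" using K1 by (simp add: C2_def add_nonneg_pos)
  define C where "C = max (2 * C1) (2 * C2)"
  have C: "2 * C1 \<le> C" "2 * C2 \<le> C" by (auto simp: C_def)
  show ?thesis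
  proof (rule that[of C])
    show "C > 0" using C C1 by linarith
    fix p s \<gamma> v \<epsilon>
    assume L2: "L2_set v {1..p} = sqrt (real p)" and s: "1 \<le> s" "s \<le> omega p v"
      and \<gamma>: "0 \<le> \<gamma>" "\<gamma> < 1" and \<epsilon>: "0 \<le> \<epsilon>" "C * ((1 - \<gamma>) * sq_rate p s) \<le> \<epsilon>\<^sup>2"
    note p = omega_bound(1)[OF s] and vS = omega_bound(2)[OF s]
    have v: "dot p v v = p" unfolding L2_set_dot[symmetric] L2 by simp
    define a where "a = sqrt (1 - \<gamma>)"
    have a: "a > 0" "a\<^sup>2 = 1 - \<gamma>" using \<gamma> by (auto simp: a_def)
    have signal: "C * sq_rate p s \<le> dot p (\<lambda>i. \<theta> i / a) (\<lambda>i. \<theta> i / a)" if "\<theta> \<in> Theta p s \<epsilon>" for \<theta>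
    proof -
      have "dot p (\<lambda>i. \<theta> i / a) (\<lambda>i. \<theta> i / a) = dot p \<theta> \<theta> / a\<^sup>2"
        by (simp add: dot_def sum_divide_distrib power2_eq_square)
      moreover have "a\<^sup>2 * (C * sq_rate p s) \<le> dot p \<theta> \<theta>"
        using \<epsilon> Theta_support(4)[OF that \<epsilon>(1)] unfolding a(2) by (simp add: mult_ac)
      ultimately show ?thesis using a(1) by (simp add: pos_le_divide_eq mult_ac)
    qed
    show "risk p s \<gamma> v \<epsilon> \<le> \<eta>"
    proof (cases "real s \<le> sqrt p")
      case True
      have s2: "(real s)\<^sup>2 \<le> p" using power_mono[OF True, of 2] by simp
      define t where "t = sqrt (ln (1 + p / (real s)\<^sup>2))"
      have ps: "p / (real s)\<^sup>2 \<ge> 1" using s2 s by (simp add: field_simps)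
      have L: "ln (1 + p / (real s)\<^sup>2) \<ge> ln 2" using ps by (subst ln_le_cancel_iff) auto
      have L0: "ln (1 + p / (real s)\<^sup>2) > 0" using L ln_gt_zero[of "2::real"] by linarith
      have t: "t > 0" "t\<^sup>2 \<ge> ln 2" "t\<^sup>2 = ln (1 + p / (real s)\<^sup>2)" using L L0 by (auto simp: t_def)
      have q: "exp (t\<^sup>2) = 1 + p / (real s)\<^sup>2" unfolding t(3) using ps by (subst exp_ln) auto
      have sq: "sqrt p \<le> s * exp (t\<^sup>2)"
      proof (rule real_le_lsqrt)
        have "real p \<le> (real s)\<^sup>2 * (1 + p / (real s)\<^sup>2)" using s by (simp add: field_simps)
        also have "\<dots> \<le> (real s)\<^sup>2 * (1 + p / (real s)\<^sup>2)\<^sup>2"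
          using ps by (intro mult_left_mono) (auto intro: self_le_power)
        finally show "real p \<le> (s * exp (t\<^sup>2))\<^sup>2" unfolding q by (simp add: power_mult_distrib)
      qed auto
      have "risk p s \<gamma> v \<epsilon> \<le> 1 / K\<^sup>2 + 9 / K\<^sup>2"
      proof (rule risk_cosh_test[OF L2 \<gamma> p s(1)])
        show "K > 0" using K1 by simp
        fix \<theta> assume \<theta>: "\<theta> \<in> Theta p s \<epsilon>"
        define S where "S = {i \<in> {1..p}. \<theta> i \<noteq> 0}"
        note S = Theta_support[OF \<theta> \<epsilon>(1), folded S_def]
        have "2 * C1 * s * t\<^sup>2 \<le> C * sq_rate p s"
          using True mult_right_mono[OF C(1), of "s * t\<^sup>2"] by (simp add: sq_rate_def t(3) mult_ac)
        also note signal[OF \<theta>]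
        finally show "measure (gauss p) {z \<in> space (Rp p). cosh_stat p v t (\<lambda>i. \<theta> i / sqrt (1 - \<gamma>) + z i)
            < p * exp (t\<^sup>2 / 2) + K * sqrt p * exp (t\<^sup>2)} \<le> 9 / K\<^sup>2"
          unfolding a_def[symmetric] using K1 S s
          by (intro cosh_stat_sparse[OF p v _ t(1,2) S(1) _ vS[OF S(1,2)] sq _ C1]) (auto simp: D_def t(1,2))
      qed
      then show ?thesis by (simp add: \<eta>K)
    next
      case False
      define t where "t = sqrt (ln (2::real))"
      have t: "t\<^sup>2 = ln 2" "t > 0" by (auto simp: t_def)
      have "risk p s \<gamma> v \<epsilon> \<le> 1 / K\<^sup>2 + 3 / (2 * K\<^sup>2)"
      proof (rule risk_cosh_test[OF L2 \<gamma> p s(1)])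
        show "K > 0" using K1 by simp
        fix \<theta> assume \<theta>: "\<theta> \<in> Theta p s \<epsilon>"
        define S where "S = {i \<in> {1..p}. \<theta> i \<noteq> 0}"
        note S = Theta_support[OF \<theta> \<epsilon>(1), folded S_def]
        define \<mu> where "\<mu> i = \<theta> i / a" for i
        have cs: "(dot p v \<mu>)\<^sup>2 \<le> p / 4 * dot p \<mu> \<mu>"
          using S(3) by (intro sparse_Cauchy_Schwarz[OF S(1) vS[OF S(1,2)]]) (simp add: \<mu>_def)
        have "2 * (C2 * sqrt p) \<le> C * sq_rate p s"
          using False mult_right_mono[OF C(2), of "sqrt p"] by (simp add: sq_rate_def)
        also have "\<dots> \<le> dot p \<mu> \<mu>" using signal[OF \<theta>] by (simp add: \<mu>_def[abs_def])
        also have "\<dots> \<le> 2 * dot p (proj p v \<mu>) (proj p v \<mu>)"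
        proof -
          have "(dot p v \<mu>)\<^sup>2 / p \<le> dot p \<mu> \<mu> / 4" using cs p by (simp add: field_simps)
          moreover have "x \<le> 2 * (x - y)" if "y \<le> x / 4" "0 \<le> x" for x y :: real using that by simp
          ultimately show ?thesis unfolding dot_proj_proj[OF p v] using dot_nonneg[of p \<mu>] by blast
        qed
        finally show "measure (gauss p) {z \<in> space (Rp p). cosh_stat p v t (\<lambda>i. \<theta> i / sqrt (1 - \<gamma>) + z i)
            < p * exp (t\<^sup>2 / 2) + K * sqrt p * exp (t\<^sup>2)} \<le> 3 / (2 * K\<^sup>2)"
          unfolding a_def[symmetric] \<mu>_def[symmetric] using K1
          by (intro cosh_stat_dense[OF p v _ t]) (auto simp: C2_def)
      qed
      also have "3 / (2 * K\<^sup>2) \<le> 9 / K\<^sup>2" using K1 by (simp add: field_simps)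
      finally show ?thesis by (simp add: \<eta>K)
    qed
  qed
qed

text \<open>
  For \<open>\<gamma> = 1\<close> the observation lies on the line through \<open>\<theta>\<close> with direction \<open>v\<close>, and no nonzero
  \<open>s\<close>-sparse vector is a multiple of \<open>v\<close>: its projection is nonzero. The test that checks
  whether the projection vanishes makes no error.
\<close>

lemma risk_degenerate:
  assumes L2: "L2_set v {1..p} = sqrt (real p)" and s: "1 \<le> s" "s \<le> omega p v" and \<epsilon>: "\<epsilon> > 0"
  shows "risk p s 1 v \<epsilon> = 0"
proof (rule antisym)
  note p = omega_bound(1)[OF s] and vS = omega_bound(2)[OF s]
  have v: "dot p v v = p" unfolding L2_set_dot[symmetric] L2 by simp
  show "0 \<le> risk p s 1 v \<epsilon>" by (rule risk_nonneg[OF L2]) (use p s in auto)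
  define R where "R x = dot p (proj p v x) (proj p v x)" for x
  have R: "R x = dot p x x - (dot p v x)\<^sup>2 / p" for x unfolding R_def by (rule dot_proj_proj[OF p v])
  have Robs: "R (obs p \<theta> 0 b v z) = R \<theta>" for \<theta> b z
  proof -
    have "proj p v (obs p \<theta> 0 b v z) i = proj p v \<theta> i" if "i \<in> {1..p}" for i
      unfolding proj_def dot_obs v using that p by (simp add: obs_def add_divide_distrib algebra_simps)
    then show ?thesis unfolding R_def by (intro dot_cong) auto
  qed
  have Rm: "R \<in> borel_measurable (Rp p)"
    unfolding R_def[abs_def] dot_def using measurable_proj
    by (intro borel_measurable_sum borel_measurable_times) auto
  note [measurable] = Rm
  define \<phi> :: "(nat \<Rightarrow> real) \<Rightarrow> nat" where "\<phi> x = (if R x \<noteq> 0 then 1 else 0)" for x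
  have "risk p s 1 v \<epsilon> \<le> 0 + 0"
  proof (rule risk_le[OF L2 _ _ p s(1)])
    show \<phi>: "\<phi> \<in> tests p"
      unfolding \<phi>_def[abs_def] by (rule test_of_pred) measurable
    have "R (\<lambda>i\<in>{1..p}. 0) = 0"
    proof -
      have "R (\<lambda>i\<in>{1..p}. 0) = R (\<lambda>i. 0)" unfolding R by (intro arg_cong2[where f = "(-)"] arg_cong[where f = "\<lambda>x. x\<^sup>2 / p"] dot_cong) auto
      then show ?thesis by (simp add: R dot_def)
    qed
    then show "measure (obs_law p (\<lambda>i\<in>{1..p}. 0) 1 v) {x \<in> space (Rp p). \<phi> x = 1} \<le> 0"
      by (subst measure_obs_law[OF L2 _ _ p sets_test[OF \<phi>]]) (auto simp: \<phi>_def Robs)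
    fix \<theta> assume \<theta>: "\<theta> \<in> Theta p s \<epsilon>"
    define S where "S = {i \<in> {1..p}. \<theta> i \<noteq> 0}"
    have \<epsilon>0: "\<epsilon> \<ge> 0" using \<epsilon> by simp
    note S = Theta_support[OF \<theta> \<epsilon>0, folded S_def]
    have "(dot p v \<theta>)\<^sup>2 \<le> p / 4 * dot p \<theta> \<theta>"
      using S(3) by (intro sparse_Cauchy_Schwarz[OF S(1) vS[OF S(1,2)]])
    then have "(dot p v \<theta>)\<^sup>2 / p \<le> dot p \<theta> \<theta> / 4" using p by (simp add: field_simps)
    moreover have "0 < \<epsilon>\<^sup>2" using \<epsilon> by simp
    moreover have "0 < x - y" if "y \<le> x / 4" "0 < e" "e \<le> x" for x y e :: real using that by linarith
    ultimately have "R \<theta> > 0" unfolding R using S(4) by blast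
    then show "measure (obs_law p \<theta> 1 v) {x \<in> space (Rp p). \<phi> x = 0} \<le> 0"
      by (subst measure_obs_law[OF L2 _ _ p sets_test[OF \<phi>]]) (auto simp: \<phi>_def Robs)
  qed auto
  then show "risk p s 1 v \<epsilon> \<le> 0" by simp
qed

section \<open>Translates of the standard normal law\<close>

text \<open>
The translation by \<open>\<mu>\<close> on the space \<open>Rp p\<close>.
\<close>

definition shift :: "nat \<Rightarrow> (nat \<Rightarrow> real) \<Rightarrow> (nat \<Rightarrow> real) \<Rightarrow> nat \<Rightarrow> real" where
  "shift p \<mu> z = (\<lambda>i\<in>{1..p}. \<mu> i + z i)"

text \<open>
  The density of the standard normal law translated by \<open>\<mu>\<close> with respect to the standard normal law,
  see \<open>gauss_shift\<close>.
\<close>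

definition shift_density :: "nat \<Rightarrow> (nat \<Rightarrow> real) \<Rightarrow> (nat \<Rightarrow> real) \<Rightarrow> real" where
  "shift_density p \<mu> z = exp (dot p \<mu> z - dot p \<mu> \<mu> / 2)"

lemma measurable_shift [measurable]: "shift p \<mu> \<in> measurable (Rp p) (Rp p)"
  unfolding shift_def[abs_def]
  by (subst (2) Rp_def, rule measurable_restrict)
     (use measurable_component_Rp in measurable)

lemma shift_space: "shift p \<mu> z \<in> space (Rp p)"
  by (auto simp: shift_def Rp_def space_PiM)

lemma measurable_shift_density [measurable]: "shift_density p \<mu> \<in> borel_measurable (Rp p)"
  unfolding shift_density_def[abs_def] by measurable

lemma emeasure_std_normal_shift:
  assumes A[measurable]: "A \<in> sets borel"
  shows "emeasure (density lborel std_normal_density) {z. m + z \<in> A}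
    = emeasure (density (density lborel std_normal_density) (\<lambda>z. ennreal (exp (m * z - m\<^sup>2 / 2)))) A"
proof -
  have eq: "std_normal_density (x - m) = std_normal_density x * exp (m * x - m\<^sup>2 / 2)" for x
    by (simp add: normal_density_def exp_add[symmetric] power2_eq_square field_simps)
  have "emeasure (density lborel std_normal_density) {z. m + z \<in> A}
      = (\<integral>\<^sup>+z. ennreal (std_normal_density z) * indicator A (m + z) \<partial>lborel)"
    by (subst emeasure_density) (auto intro!: nn_integral_cong simp: indicator_def)
  also have "\<dots> = (\<integral>\<^sup>+x. ennreal (std_normal_density (x - m)) * indicator A x \<partial>lborel)"
    by (subst (2) nn_integral_real_affine[where c = 1 and t = m]) auto
  also have "\<dots> = (\<integral>\<^sup>+x. ennreal (std_normal_density x) * (ennreal (exp (m * x - m\<^sup>2 / 2)) * indicator A x) \<partial>lborel)"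
    unfolding eq by (intro nn_integral_cong) (auto simp: indicator_def ennreal_mult)
  also have "\<dots> = emeasure (density (density lborel std_normal_density) (\<lambda>z. ennreal (exp (m * z - m\<^sup>2 / 2)))) A"
    by (subst emeasure_density, simp, simp, subst nn_integral_density) auto
  finally show ?thesis .
qed

lemma gauss_shift:
  "distr (gauss p) (Rp p) (shift p \<mu>) = density (gauss p) (\<lambda>z. ennreal (shift_density p \<mu> z))"
proof -
  let ?N = "density lborel (\<lambda>x. ennreal (std_normal_density x))"
  define N' where "N' i = density ?N (\<lambda>z. ennreal (exp (\<mu> i * z - (\<mu> i)\<^sup>2 / 2)))" for i
  interpret N: product_prob_space "\<lambda>_. ?N" "{1..p}"
    by (intro product_prob_spaceI prob_space_normal_density) simp
  have em: "emeasure (N' i) A = emeasure ?N {z. \<mu> i + z \<in> A}" if "A \<in> sets borel" for i A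
    unfolding N'_def using emeasure_std_normal_shift[OF that] by simp
  have "prob_space (N' i)" for i
  proof
    have "emeasure (N' i) UNIV = 1"
      using em[of UNIV i] prob_space.emeasure_space_1[OF prob_space_normal_density[of 1 0]] by simp
    then show "emeasure (N' i) (space (N' i)) = 1" by (simp add: N'_def)
  qed
  then interpret N': product_prob_space N' "{1..p}" by (rule product_prob_spaceI)
  have setsN': "sets (N' i) = sets borel" for i by (simp add: N'_def)
  have sets_P: "sets (Rp p) = sets (PiM {1..p} N')"
    unfolding Rp_def by (intro sets_PiM_cong) (auto simp: setsN')
  have "distr (gauss p) (Rp p) (shift p \<mu>) = PiM {1..p} N'"
  proof (rule N'.PiM_eqI)
    show "sets (distr (gauss p) (Rp p) (shift p \<mu>)) = sets (PiM {1..p} N')" by (simp add: sets_P)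
    fix A assume "\<And>i. i \<in> {1..p} \<Longrightarrow> A i \<in> sets (N' i)"
    then have A: "A i \<in> sets borel" if "i \<in> {1..p}" for i using that by (simp add: setsN')
    then have AP: "Pi\<^sub>E {1..p} A \<in> sets (Rp p)" unfolding Rp_def by (intro sets_PiM_I_finite) auto
    have m: "shift p \<mu> \<in> measurable (gauss p) (Rp p)" by measurable
    have [measurable]: "{z. \<mu> i + z \<in> A i} \<in> sets borel" if "i \<in> {1..p}" for i
    proof -
      note A[OF that, measurable]
      show ?thesis by measurable
    qed
    have "emeasure (distr (gauss p) (Rp p) (shift p \<mu>)) (Pi\<^sub>E {1..p} A)
        = emeasure (gauss p) (Pi\<^sub>E {1..p} (\<lambda>i. {z. \<mu> i + z \<in> A i}))"
      unfolding emeasure_distr[OF m AP]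
      by (intro arg_cong[where f = "emeasure (gauss p)"])
         (auto simp: shift_def gauss_def space_PiM PiE_iff split: if_splits)
    also have "\<dots> = (\<Prod>i\<in>{1..p}. emeasure ?N {z. \<mu> i + z \<in> A i})"
      unfolding gauss_def by (intro N.emeasure_PiM) auto
    also have "\<dots> = (\<Prod>i\<in>{1..p}. emeasure (N' i) (A i))"
      using em A by (intro prod.cong) auto
    finally show "emeasure (distr (gauss p) (Rp p) (shift p \<mu>)) (Pi\<^sub>E {1..p} A)
        = (\<Prod>i\<in>{1..p}. emeasure (N' i) (A i))" .
  qed simp
  moreover have "density (gauss p) (\<lambda>z. ennreal (shift_density p \<mu> z)) = PiM {1..p} N'"
  proof (rule N'.PiM_eqI)
    show "sets (density (gauss p) (\<lambda>z. ennreal (shift_density p \<mu> z))) = sets (PiM {1..p} N')"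
      unfolding sets_density sets_gauss by (rule sets_P)
    fix A assume "\<And>i. i \<in> {1..p} \<Longrightarrow> A i \<in> sets (N' i)"
    then have A: "A i \<in> sets borel" if "i \<in> {1..p}" for i using that by (simp add: setsN')
    then have AP: "Pi\<^sub>E {1..p} A \<in> sets (gauss p)" unfolding gauss_def by (intro sets_PiM_I_finite) auto
    have "emeasure (density (gauss p) (\<lambda>z. ennreal (shift_density p \<mu> z))) (Pi\<^sub>E {1..p} A)
        = (\<integral>\<^sup>+z. ennreal (shift_density p \<mu> z) * indicator (Pi\<^sub>E {1..p} A) z \<partial>gauss p)"
      using AP by (subst emeasure_density) auto
    also have "\<dots> = (\<integral>\<^sup>+z. (\<Prod>i\<in>{1..p}. ennreal (exp (\<mu> i * z i - (\<mu> i)\<^sup>2 / 2)) * indicator (A i) (z i)) \<partial>gauss p)"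
    proof (intro nn_integral_cong)
      fix z assume z: "z \<in> space (gauss p)"
      have "shift_density p \<mu> z = (\<Prod>i\<in>{1..p}. exp (\<mu> i * z i - (\<mu> i)\<^sup>2 / 2))"
        by (simp add: shift_density_def dot_def exp_sum[symmetric] sum_subtractf sum_divide_distrib power2_eq_square)
      moreover have "(indicator (Pi\<^sub>E {1..p} A) z :: ennreal) = (\<Prod>i\<in>{1..p}. indicator (A i) (z i))"
        using z by (auto simp: indicator_def space_gauss Rp_def space_PiM PiE_iff prod_zero_iff)
      ultimately show "ennreal (shift_density p \<mu> z) * indicator (Pi\<^sub>E {1..p} A) z
          = (\<Prod>i\<in>{1..p}. ennreal (exp (\<mu> i * z i - (\<mu> i)\<^sup>2 / 2)) * indicator (A i) (z i))"
        by (simp add: prod.distrib prod_ennreal)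
    qed
    also have "\<dots> = (\<Prod>i\<in>{1..p}. \<integral>\<^sup>+z. ennreal (exp (\<mu> i * z - (\<mu> i)\<^sup>2 / 2)) * indicator (A i) z \<partial>?N)"
      unfolding gauss_def
    proof (rule N.product_nn_integral_prod)
      fix i assume "i \<in> {1..p}"
      note A[OF this, measurable]
      show "(\<lambda>z. ennreal (exp (\<mu> i * z - (\<mu> i)\<^sup>2 / 2)) * indicator (A i) z) \<in> borel_measurable ?N"
        by measurable
    qed simp
    also have "\<dots> = (\<Prod>i\<in>{1..p}. emeasure (N' i) (A i))"
      using A by (intro prod.cong) (auto simp: N'_def emeasure_density)
    finally show "emeasure (density (gauss p) (\<lambda>z. ennreal (shift_density p \<mu> z))) (Pi\<^sub>E {1..p} A)
        = (\<Prod>i\<in>{1..p}. emeasure (N' i) (A i))" .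
  qed simp
  ultimately show ?thesis by simp
qed

lemma shift_density_integrable: "integrable (gauss p) (shift_density p \<mu>)"
  unfolding shift_density_def[abs_def] exp_diff by (intro integrable_divide integrable_exp_dot)

lemma measure_gauss_shift:
  assumes A: "A \<in> sets (Rp p)"
  shows "measure (gauss p) {z \<in> space (Rp p). shift p \<mu> z \<in> A}
    = (\<integral>z. indicator A z * shift_density p \<mu> z \<partial>gauss p)"
proof -
  have m: "shift p \<mu> \<in> measurable (gauss p) (Rp p)" by measurable
  have [measurable]: "A \<in> sets (gauss p)" using A by (simp add: sets_gauss)
  have "measure (gauss p) {z \<in> space (Rp p). shift p \<mu> z \<in> A} = measure (distr (gauss p) (Rp p) (shift p \<mu>)) A"
    unfolding measure_distr[OF m A]
    by (intro arg_cong[where f = "measure (gauss p)"]) (auto simp: space_gauss)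
  also have "\<dots> = (\<integral>z. indicator A z \<partial>density (gauss p) (\<lambda>z. ennreal (shift_density p \<mu> z)))"
    unfolding gauss_shift using sets.sets_into_space[OF A] by (simp add: space_gauss inf.absorb1)
  also have "\<dots> = (\<integral>z. shift_density p \<mu> z *\<^sub>R indicator A z \<partial>gauss p)"
    by (rule integral_density) (auto simp: shift_density_def)
  finally show ?thesis by (simp add: mult.commute)
qed

lemma shift_density_product:
  shows "integrable (gauss p) (\<lambda>z. shift_density p \<mu> z * shift_density p \<nu> z)"
    and "(\<integral>z. shift_density p \<mu> z * shift_density p \<nu> z \<partial>gauss p) = exp (dot p \<mu> \<nu>)"
proof -
  have eq: "shift_density p \<mu> z * shift_density p \<nu> z
      = exp (- (dot p \<mu> \<mu> + dot p \<nu> \<nu>) / 2) * exp (dot p (\<lambda>i. \<mu> i + \<nu> i) z)" for z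
    unfolding shift_density_def dot_linear by (simp add: exp_add[symmetric] field_simps)
  show "integrable (gauss p) (\<lambda>z. shift_density p \<mu> z * shift_density p \<nu> z)"
    unfolding eq by (intro integrable_mult_right integrable_exp_dot)
  show "(\<integral>z. shift_density p \<mu> z * shift_density p \<nu> z \<partial>gauss p) = exp (dot p \<mu> \<nu>)"
    unfolding eq integral_mult_right_zero integral_exp_dot unfolding dot_linear
    by (simp add: exp_add[symmetric] dot_commute[of p \<nu> \<mu>] field_simps)
qed

lemma integral_shift_density: "(\<integral>z. shift_density p \<mu> z \<partial>gauss p) = 1"
  unfolding shift_density_def exp_diff by (simp add: integral_exp_dot)

text \<open>
  The second moment method: with \<open>L\<close> the density of the uniform mixture of the translates, the sum of
  the two errors of a test is at least \<open>1 - E \<bar>L - 1\<bar>\<close>, and the hypothesis bounds \<open>E (L - 1)\<^sup>2\<close> by \<open>\<delta>\<^sup>2\<close>.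
\<close>

lemma mixture_testing_bound:
  fixes \<delta> :: real
  assumes T: "finite T" "T \<noteq> {}" and B: "B \<in> sets (Rp p)" and \<delta>: "\<delta> > 0"
    and chi: "(\<Sum>j\<in>T. \<Sum>k\<in>T. exp (dot p (\<mu> j) (\<mu> k))) \<le> (1 + \<delta>\<^sup>2) * (card T)\<^sup>2"
  shows "1 - \<delta> \<le> measure (gauss p) B
    + (\<Sum>j\<in>T. measure (gauss p) {z \<in> space (Rp p). shift p (\<mu> j) z \<in> space (Rp p) - B}) / card T"
proof -
  interpret prob_space "gauss p" by (rule prob_space_gauss)
  define n where "n = real (card T)"
  have n: "n > 0" using T by (simp add: n_def card_gt_0_iff)
  define L where "L z = (\<Sum>j\<in>T. shift_density p (\<mu> j) z) / n" for z
  have Li: "integrable (gauss p) L"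
    unfolding L_def[abs_def] by (intro integrable_divide Bochner_Integration.integrable_sum shift_density_integrable)
  have L1: "(\<integral>z. L z \<partial>gauss p) = 1"
    unfolding L_def using n
    by (simp add: Bochner_Integration.integral_sum shift_density_integrable integral_shift_density n_def)
  have LL: "(L z)\<^sup>2 = (\<Sum>j\<in>T. \<Sum>k\<in>T. shift_density p (\<mu> j) z * shift_density p (\<mu> k) z) / n\<^sup>2" for z
    by (simp add: L_def power_divide power2_eq_square sum_product)
  have L2i: "integrable (gauss p) (\<lambda>z. (L z)\<^sup>2)"
    unfolding LL by (intro integrable_divide Bochner_Integration.integrable_sum shift_density_product)
  have L2: "(\<integral>z. (L z)\<^sup>2 \<partial>gauss p) \<le> 1 + \<delta>\<^sup>2"
  proof -
    have "(\<integral>z. (L z)\<^sup>2 \<partial>gauss p) = (\<Sum>j\<in>T. \<Sum>k\<in>T. exp (dot p (\<mu> j) (\<mu> k))) / n\<^sup>2"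
      unfolding LL
      by (simp add: Bochner_Integration.integral_sum Bochner_Integration.integrable_sum shift_density_product)
    also have "\<dots> \<le> 1 + \<delta>\<^sup>2" using chi n by (simp add: n_def divide_le_eq)
    finally show ?thesis .
  qed
  have [measurable]: "B \<in> sets (gauss p)" using B by (simp add: sets_gauss)
  define B' where "B' = space (Rp p) - B"
  have B'[measurable]: "B' \<in> sets (Rp p)" using B by (auto simp: B'_def)
  have dev: "(\<integral>z. ((L z)\<^sup>2 - 2 * L z + 1) / \<delta> + \<delta> \<partial>gauss p) \<le> 2 * \<delta>"
  proof -
    have "(\<integral>z. ((L z)\<^sup>2 - 2 * L z + 1) / \<delta> + \<delta> \<partial>gauss p) = ((\<integral>z. (L z)\<^sup>2 \<partial>gauss p) - 2 * 1 + 1) / \<delta> + \<delta>"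
      using L2i Li by (simp add: L1 prob_space)
    also have "\<dots> \<le> \<delta>\<^sup>2 / \<delta> + \<delta>" using L2 \<delta> by (intro add_right_mono divide_right_mono) auto
    finally show ?thesis using \<delta> by (simp add: power2_eq_square)
  qed
  have devi: "integrable (gauss p) (\<lambda>z. ((L z)\<^sup>2 - 2 * L z + 1) / \<delta> + \<delta>)"
    using L2i Li by simp
  have pw: "1 - (((L z)\<^sup>2 - 2 * L z + 1) / \<delta> + \<delta>) / 2 \<le> indicator B z + indicator B' z * L z"
    if z: "z \<in> space (gauss p)" for z
  proof -
    have "0 \<le> (\<bar>L z - 1\<bar> - \<delta>)\<^sup>2" by simp
    also have "\<dots> = ((L z)\<^sup>2 - 2 * L z + 1) - 2 * \<delta> * \<bar>L z - 1\<bar> + \<delta>\<^sup>2"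
      by (simp add: power2_diff)
    finally have "\<bar>L z - 1\<bar> \<le> (((L z)\<^sup>2 - 2 * L z + 1) / \<delta> + \<delta>) / 2"
      using \<delta> by (simp add: field_simps power2_eq_square)
    moreover have "1 - \<bar>L z - 1\<bar> \<le> indicator B z + indicator B' z * L z"
      using z by (auto simp: B'_def space_gauss indicator_def)
    ultimately show ?thesis by linarith
  qed
  have B'L: "integrable (gauss p) (\<lambda>z. indicator B' z * f z)" if "integrable (gauss p) f" for f :: "_ \<Rightarrow> real"
    using integrable_mult_indicator[of B' "gauss p" f] that by (simp add: sets_gauss)
  have "1 - \<delta> \<le> (\<integral>z. 1 - (((L z)\<^sup>2 - 2 * L z + 1) / \<delta> + \<delta>) / 2 \<partial>gauss p)"
    using devi dev by (subst Bochner_Integration.integral_diff) (auto simp: prob_space)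
  also have "\<dots> \<le> (\<integral>z. indicator B z + indicator B' z * L z \<partial>gauss p)"
    using devi B'L[OF Li] pw
    by (intro integral_mono Bochner_Integration.integrable_diff Bochner_Integration.integrable_add)
       (auto simp: less_top[symmetric])
  also have "\<dots> = measure (gauss p) B + (\<integral>z. indicator B' z * L z \<partial>gauss p)"
    using B'L[OF Li] sets.sets_into_space[OF B]
    by (subst Bochner_Integration.integral_add) (auto simp: less_top[symmetric] space_gauss inf.absorb1)
  also have "(\<integral>z. indicator B' z * L z \<partial>gauss p)
      = (\<Sum>j\<in>T. \<integral>z. indicator B' z * shift_density p (\<mu> j) z \<partial>gauss p) / n"
    unfolding L_def times_divide_eq_right sum_distrib_left
    by (simp add: Bochner_Integration.integral_sum B'L shift_density_integrable)
  also have "\<dots> = (\<Sum>j\<in>T. measure (gauss p) {z \<in> space (Rp p). shift p (\<mu> j) z \<in> B'}) / n"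
    by (simp add: measure_gauss_shift[OF B'])
  finally show ?thesis by (simp add: B'_def n_def)
qed

section \<open>Lower bound\<close>

text \<open>
  The noise transformation is invertible if \<open>\<gamma> < 1\<close>, and turns \<open>\<theta> j\<close> into the mean \<open>\<mu> j\<close> of a standard
  normal vector. The spike reduces the inner product of \<open>\<mu> j\<close> and \<open>\<mu> k\<close> by a nonnegative
  multiple of the product of \<open>dot p v (\<theta> j)\<close> and \<open>dot p v (\<theta> k)\<close>. If these have the same sign,
  the correlation of the noise may be ignored.
\<close>

lemma risk_mixture_lower:
  fixes \<delta> :: real
  assumes vp: "L2_set v {1..p} = sqrt (real p)" "0 \<le> \<gamma>" "\<gamma> < 1" "p \<ge> 1"
    and T: "finite T" "T \<noteq> {}" and \<delta>: "\<delta> > 0"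
    and \<theta>: "\<And>j. j \<in> T \<Longrightarrow> \<theta> j \<in> Theta p s \<epsilon>" "\<And>j. j \<in> T \<Longrightarrow> 0 \<le> dot p v (\<theta> j)"
    and chi: "(\<Sum>j\<in>T. \<Sum>k\<in>T. exp (dot p (\<theta> j) (\<theta> k) / (1 - \<gamma>))) \<le> (1 + \<delta>\<^sup>2) * (card T)\<^sup>2"
  shows "1 - \<delta> \<le> risk p s \<gamma> v \<epsilon>"
proof (rule risk_ge)
  have vp': "\<gamma> \<le> 1" using vp by simp
  have v: "dot p v v = p" unfolding L2_set_dot[symmetric] vp(1) by simp
  define a where "a = sqrt (1 - \<gamma>)"
  define b where "b = spike_coeff p \<gamma>"
  have a: "a > 0" "a\<^sup>2 = 1 - \<gamma>" using vp by (auto simp: a_def)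
  have b: "b \<ge> 0" using vp by (auto simp: b_def spike_coeff_def intro!: divide_nonneg_nonneg)
  have abp: "a + b * p > 0" using a b by (simp add: add_pos_nonneg)
  \<comment> \<open>The inverse of \<open>a I + b v v\<^sup>T\<close> is \<open>(I - d v v\<^sup>T) / a\<close>.\<close>
  define d where "d = b / (a + b * p)"
  have d: "0 \<le> d" "d * p \<le> 1" using abp a b by (auto simp: d_def divide_simps)
  define \<mu> where "\<mu> j = (\<lambda>i. 1 / a * (\<theta> j i - d * dot p v (\<theta> j) * v i))" for j
  have v\<mu>: "b * dot p v (\<mu> j) = d * dot p v (\<theta> j)" for j
  proof -
    have "dot p v (\<mu> j) = 1 / a * (dot p v (\<theta> j) - d * dot p v (\<theta> j) * p)"
      unfolding \<mu>_def dot_linear v ..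
    also have "\<dots> = dot p v (\<theta> j) / (a + b * p)"
      using abp a by (simp add: d_def field_simps)
    finally show ?thesis by (simp add: d_def)
  qed
  have obs: "obs p (\<theta> j) a b v z = obs p (\<lambda>i\<in>{1..p}. 0) a b v (shift p (\<mu> j) z)" for j z
  proof
    fix i
    have "dot p v (shift p (\<mu> j) z) = dot p v (\<mu> j) + dot p v z"
      unfolding dot_add_right[symmetric] by (intro dot_cong) (auto simp: shift_def)
    then have "b * dot p v (shift p (\<mu> j) z) = d * dot p v (\<theta> j) + b * dot p v z"
      by (simp add: distrib_left v\<mu>)
    then show "obs p (\<theta> j) a b v z i = obs p (\<lambda>i\<in>{1..p}. 0) a b v (shift p (\<mu> j) z) i"
      using a by (simp add: obs_def) (auto simp: shift_def \<mu>_def algebra_simps)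
  qed
  have \<mu>\<mu>: "dot p (\<mu> j) (\<mu> k) \<le> dot p (\<theta> j) (\<theta> k) / (1 - \<gamma>)" if "j \<in> T" "k \<in> T" for j k
  proof -
    define w where "w = dot p v (\<theta> j) * dot p v (\<theta> k)"
    have w: "w \<ge> 0" using \<theta>(2) that by (simp add: w_def)
    have "dot p (\<mu> j) (\<mu> k) = (dot p (\<theta> j) (\<theta> k) - d * (2 - d * p) * w) / a\<^sup>2"
      unfolding \<mu>_def dot_linear v dot_commute[of p "\<theta> j" v] w_def using a
      by (simp add: field_simps power2_eq_square)
    also have "\<dots> \<le> dot p (\<theta> j) (\<theta> k) / a\<^sup>2"
    proof -
      have "0 \<le> d * (2 - d * p) * w" using d w by (intro mult_nonneg_nonneg) auto
      then show ?thesis by (intro divide_right_mono) auto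
    qed
    finally show ?thesis unfolding a(2) .
  qed
  fix \<phi> assume \<phi>: "\<phi> \<in> tests p"
  define o0 where "o0 = obs p (\<lambda>i\<in>{1..p}. 0) a b v"
  define B where "B = {z \<in> space (Rp p). \<phi> (o0 z) = 1}"
  define \<beta> where "\<beta> \<theta> = measure (obs_law p \<theta> \<gamma> v) {x \<in> space (Rp p). \<phi> x = 0}" for \<theta>
  have o0m: "o0 \<in> measurable (Rp p) (Rp p)" unfolding o0_def by measurable
  have o0s: "o0 z \<in> space (Rp p)" for z by (auto simp: o0_def obs_def Rp_def space_PiM)
  have "B = o0 -` {x \<in> space (Rp p). \<phi> x = 1} \<inter> space (Rp p)" using o0s by (auto simp: B_def)
  then have B: "B \<in> sets (Rp p)" using measurable_sets[OF o0m sets_test[OF \<phi>]] by simp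
  have "\<phi> x \<in> {0, 1}" if "x \<in> space (Rp p)" for x
    using measurable_space[of \<phi> "Rp p" "count_space {0, 1}" x] \<phi> that by (simp add: tests_def)
  then have \<phi>01: "\<phi> (o0 z) = 0 \<longleftrightarrow> \<phi> (o0 z) \<noteq> 1" for z using o0s[of z] by fastforce
  have P0: "measure (obs_law p (\<lambda>i\<in>{1..p}. 0) \<gamma> v) {x \<in> space (Rp p). \<phi> x = 1} = measure (gauss p) B"
    by (subst measure_obs_law[OF vp(1,2) vp' vp(4) sets_test[OF \<phi>]])
       (simp add: B_def o0_def a_def b_def)
  have P1: "measure (gauss p) {z \<in> space (Rp p). shift p (\<mu> j) z \<in> space (Rp p) - B} = \<beta> (\<theta> j)" for j
    unfolding \<beta>_def measure_obs_law[OF vp(1,2) vp' vp(4) sets_test[OF \<phi>]] a_def[symmetric] b_def[symmetric]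
      obs o0_def[symmetric]
    by (intro arg_cong[where f = "measure (gauss p)"]) (auto simp: B_def \<phi>01 shift_space)
  have "(\<Sum>j\<in>T. \<Sum>k\<in>T. exp (dot p (\<mu> j) (\<mu> k))) \<le> (1 + \<delta>\<^sup>2) * (card T)\<^sup>2"
    by (rule order_trans[OF _ chi]) (auto intro!: sum_mono \<mu>\<mu>)
  from mixture_testing_bound[OF T B \<delta> this]
  have "1 - \<delta> \<le> measure (gauss p) B + (\<Sum>j\<in>T. \<beta> (\<theta> j)) / card T"
    unfolding P1 .
  also have "(\<Sum>j\<in>T. \<beta> (\<theta> j)) / card T \<le> (SUP \<theta> \<in> Theta p s \<epsilon>. \<beta> \<theta>)"
  proof -
    have "(\<Sum>j\<in>T. \<beta> (\<theta> j)) \<le> (\<Sum>j\<in>T. (SUP \<theta> \<in> Theta p s \<epsilon>. \<beta> \<theta>))"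
      unfolding \<beta>_def by (intro sum_mono cSUP_upper \<theta> bdd_above_type_II vp vp')
    then show ?thesis using T by (simp add: divide_le_eq card_gt_0_iff mult.commute)
  qed
  finally show "1 - \<delta> \<le> measure (obs_law p (\<lambda>i\<in>{1..p}. 0) \<gamma> v) {x \<in> space (Rp p). \<phi> x = 1} +
        (SUP \<theta> \<in> Theta p s \<epsilon>. measure (obs_law p \<theta> \<gamma> v) {x \<in> space (Rp p). \<phi> x = 0})"
    unfolding P0 \<beta>_def by simp
qed

text \<open>
  Cut the positive integers into consecutive blocks of length \<open>m\<close>, the first of which is \<open>{1..m}\<close>.
  This is the position in block number \<open>k\<close>, counted from \<open>0\<close>, that has offset \<open>J k\<close>.
\<close>

definition block_pos :: "nat \<Rightarrow> (nat \<Rightarrow> nat) \<Rightarrow> nat \<Rightarrow> nat" where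
  "block_pos m J k = k * m + J k + 1"

text \<open>
  A vector in the support of the prior: \<open>J\<close> selects one position in each of the first \<open>s\<close> blocks. The
  selected coordinates have modulus \<open>\<tau>\<close> and the sign of the corresponding coordinate of \<open>v\<close>,
  which makes the inner product with \<open>v\<close> nonnegative. Selecting per block rather than a subset
  of \<open>{1..p}\<close> makes the overlap of the supports of two independent copies binomial.
\<close>

definition block_vec ::
  "nat \<Rightarrow> nat \<Rightarrow> nat \<Rightarrow> real \<Rightarrow> (nat \<Rightarrow> real) \<Rightarrow> (nat \<Rightarrow> nat) \<Rightarrow> nat \<Rightarrow> real" where
  "block_vec p s m \<tau> v J = (\<lambda>i\<in>{1..p}.
     if i \<in> block_pos m J ` {..<s} then (if v i < 0 then - \<tau> else \<tau>) else 0)"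

lemma block_pos_eq_iff:
  assumes "J k < m" "J' k' < m"
  shows "block_pos m J k = block_pos m J' k' \<longleftrightarrow> k = k' \<and> J k = J' k'"
proof
  assume "block_pos m J k = block_pos m J' k'"
  then have eq: "k * m + J k = k' * m + J' k'" by (simp add: block_pos_def)
  have "(k * m + J k) div m = k" "(k' * m + J' k') div m = k'" using assms by auto
  with eq show "k = k' \<and> J k = J' k'" by auto
qed (auto simp: block_pos_def)

lemma block_pos_range:
  assumes "J k < m" "k < s" "s * m \<le> p"
  shows "block_pos m J k \<in> {1..p}"
proof -
  have "(k + 1) * m \<le> s * m" using assms by (intro mult_le_mono1) auto
  then show ?thesis using assms by (simp add: block_pos_def)
qed

lemma block_vec_dot:
  assumes J: "J \<in> {..<s} \<rightarrow> {..<m}" and J': "J' \<in> {..<s} \<rightarrow> {..<m}" and sm: "s * m \<le> p"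
  shows "dot p (block_vec p s m \<tau> v J) (block_vec p s m \<tau> v J')
    = (\<Sum>k<s. if J k = J' k then \<tau>\<^sup>2 else 0)"
proof -
  have inj: "inj_on (block_pos m J) {..<s}"
    by (rule inj_onI) (use J block_pos_eq_iff[of J _ m J] in \<open>auto simp: Pi_iff\<close>)
  have sub: "block_pos m J ` {..<s} \<subseteq> {1..p}"
  proof (rule image_subsetI)
    fix k assume "k \<in> {..<s}"
    then show "block_pos m J k \<in> {1..p}" using J by (intro block_pos_range[OF _ _ sm]) auto
  qed
  have "dot p (block_vec p s m \<tau> v J) (block_vec p s m \<tau> v J')
      = (\<Sum>i\<in>block_pos m J ` {..<s}. if i \<in> block_pos m J' ` {..<s} then \<tau>\<^sup>2 else 0)"
    unfolding dot_def using sub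
    by (intro sum.mono_neutral_cong_right) (auto simp: block_vec_def power2_eq_square simp del: One_nat_def)
  also have "\<dots> = (\<Sum>k<s. if block_pos m J k \<in> block_pos m J' ` {..<s} then \<tau>\<^sup>2 else 0)"
    by (subst sum.reindex[OF inj]) simp
  also have "\<dots> = (\<Sum>k<s. if J k = J' k then \<tau>\<^sup>2 else 0)"
  proof (intro sum.cong refl)
    fix k assume k: "k \<in> {..<s}"
    have "block_pos m J k \<in> block_pos m J' ` {..<s} \<longleftrightarrow> J k = J' k"
      using J J' k block_pos_eq_iff[of J k m J'] by (auto simp: Pi_iff image_iff)
    then show "(if block_pos m J k \<in> block_pos m J' ` {..<s} then \<tau>\<^sup>2 else 0)
      = (if J k = J' k then \<tau>\<^sup>2 else 0)" by simp
  qed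
  finally show ?thesis .
qed

lemma risk_block_lower:
  fixes \<gamma> \<epsilon> \<delta> :: real and s0 s m :: nat
  assumes vp: "L2_set v {1..p} = sqrt (real p)" "0 \<le> \<gamma>" "\<gamma> < 1" "p \<ge> 1"
    and s0: "1 \<le> s0" "s0 \<le> s" and m: "1 \<le> m" "s0 * m \<le> p" and \<delta>: "\<delta> > 0" and \<epsilon>: "\<epsilon> \<ge> 0"
    and chi: "exp (s0 * (exp (\<epsilon>\<^sup>2 / (s0 * (1 - \<gamma>))) - 1) / m) \<le> 1 + \<delta>\<^sup>2"
  shows "1 - \<delta> \<le> risk p s \<gamma> v \<epsilon>"
proof -
  define \<tau> where "\<tau> = \<epsilon> / sqrt s0"
  have \<tau>: "\<tau> \<ge> 0" "s0 * \<tau>\<^sup>2 = \<epsilon>\<^sup>2" using \<epsilon> s0 by (auto simp: \<tau>_def power_divide)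
  \<comment> \<open>The second moment factorises over the blocks.\<close>
  define T where "T = PiE {..<s0} (\<lambda>_. {..<m})"
  define \<theta> where "\<theta> = block_vec p s0 m \<tau> v"
  define x where "x = exp (\<tau>\<^sup>2 / (1 - \<gamma>))"
  have x: "x = exp (\<epsilon>\<^sup>2 / (s0 * (1 - \<gamma>)))" using s0 by (simp add: x_def \<tau>(2)[symmetric])
  have J: "J \<in> {..<s0} \<rightarrow> {..<m}" if "J \<in> T" for J using that by (auto simp: T_def)
  have cT: "card T = m ^ s0" by (simp add: T_def card_PiE)
  have row: "(\<Sum>J'\<in>T. exp (dot p (\<theta> J) (\<theta> J') / (1 - \<gamma>))) = (real m - 1 + x) ^ s0" if JT: "J \<in> T" for J
  proof -
    have "(\<Sum>J'\<in>T. exp (dot p (\<theta> J) (\<theta> J') / (1 - \<gamma>)))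
        = (\<Sum>J'\<in>T. \<Prod>k\<in>{..<s0}. if J k = J' k then x else 1)"
    proof (intro sum.cong refl)
      fix J' assume "J' \<in> T"
      have "exp (dot p (\<theta> J) (\<theta> J') / (1 - \<gamma>)) = (\<Prod>k\<in>{..<s0}. exp ((if J k = J' k then \<tau>\<^sup>2 else 0) / (1 - \<gamma>)))"
        unfolding \<theta>_def block_vec_dot[OF J[OF JT] J[OF \<open>J' \<in> T\<close>] m(2)]
        by (simp add: exp_sum[symmetric] sum_divide_distrib)
      also have "\<dots> = (\<Prod>k\<in>{..<s0}. if J k = J' k then x else 1)"
        by (intro prod.cong) (auto simp: x_def)
      finally show "exp (dot p (\<theta> J) (\<theta> J') / (1 - \<gamma>)) = (\<Prod>k\<in>{..<s0}. if J k = J' k then x else 1)" .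
    qed
    also have "\<dots> = (\<Prod>k\<in>{..<s0}. \<Sum>r\<in>{..<m}. if J k = r then x else 1)"
      unfolding T_def by (rule prod_sum_PiE[symmetric]) auto
    also have "\<dots> = (\<Prod>k\<in>{..<s0}. real m - 1 + x)"
    proof (intro prod.cong refl)
      fix k assume "k \<in> {..<s0}"
      then have "J k < m" using J[OF JT] by auto
      have "(\<Sum>r\<in>{..<m}. if J k = r then x else 1) = (\<Sum>r\<in>{..<m}. 1 + (if J k = r then x - 1 else 0))"
        by (intro sum.cong) auto
      then show "(\<Sum>r\<in>{..<m}. if J k = r then x else 1) = real m - 1 + x"
        using \<open>J k < m\<close> by (simp add: sum.distrib)
    qed
    finally show ?thesis by simp
  qed
  have m0: "real m > 0" using m by simp
  have "(1 + (x - 1) / m) ^ s0 \<le> exp ((x - 1) / m) ^ s0"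
  proof (rule power_mono)
    have "x \<ge> 1" using vp by (simp add: x_def)
    then show "0 \<le> 1 + (x - 1) / m" using m0 by simp
  qed (rule exp_ge_add_one_self)
  also have "exp ((x - 1) / m) ^ s0 = exp (s0 * (x - 1) / m)"
    by (simp add: exp_of_nat_mult[symmetric])
  also have "\<dots> \<le> 1 + \<delta>\<^sup>2" using chi by (simp add: x)
  finally have "m ^ s0 * (1 + (x - 1) / m) ^ s0 \<le> m ^ s0 * (1 + \<delta>\<^sup>2)" by (rule mult_left_mono) simp
  moreover have "m ^ s0 * (1 + (x - 1) / m) ^ s0 = (real m - 1 + x) ^ s0"
    using m0 by (simp add: power_mult_distrib[symmetric] field_simps)
  ultimately have bound: "(real m - 1 + x) ^ s0 \<le> m ^ s0 * (1 + \<delta>\<^sup>2)" by simp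
  show ?thesis
  proof (rule risk_mixture_lower[OF vp])
    show "finite T" by (simp add: T_def finite_PiE)
    show "T \<noteq> {}" using m by (auto simp: T_def PiE_eq_empty_iff lessThan_empty_iff)
    show "\<delta> > 0" by fact
    fix J assume JT: "J \<in> T"
    have "dot p (\<theta> J) (\<theta> J) = \<epsilon>\<^sup>2"
      unfolding \<theta>_def block_vec_dot[OF J[OF JT] J[OF JT] m(2)] using \<tau> by simp
    then have "L2_set (\<theta> J) {1..p} = \<epsilon>" using \<epsilon> unfolding L2_set_eq_sqrt_dot by simp
    moreover have "norm0 p (\<theta> J) \<le> s"
    proof -
      have "norm0 p (\<theta> J) \<le> card (block_pos m J ` {..<s0})"
        unfolding norm0_def by (intro card_mono) (auto simp: \<theta>_def block_vec_def split: if_splits)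
      also have "\<dots> \<le> s0" using card_image_le[of "{..<s0}"] by simp
      finally show ?thesis using s0 by simp
    qed
    ultimately show "\<theta> J \<in> Theta p s \<epsilon>"
      by (auto simp: Theta_def \<theta>_def block_vec_def Rp_def space_PiM)
    show "0 \<le> dot p v (\<theta> J)"
      unfolding dot_def \<theta>_def block_vec_def using \<tau> 
      by (intro sum_nonneg) (auto simp: mult_nonpos_nonneg)
  next
    have "(\<Sum>J\<in>T. \<Sum>J'\<in>T. exp (dot p (\<theta> J) (\<theta> J') / (1 - \<gamma>))) = m ^ s0 * (real m - 1 + x) ^ s0"
      by (simp add: row cT)
    also have "\<dots> \<le> m ^ s0 * (m ^ s0 * (1 + \<delta>\<^sup>2))" using bound by (intro mult_left_mono) auto
    finally show "(\<Sum>J\<in>T. \<Sum>J'\<in>T. exp (dot p (\<theta> J) (\<theta> J') / (1 - \<gamma>))) \<le> (1 + \<delta>\<^sup>2) * (card T)\<^sup>2"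
      by (simp add: cT power2_eq_square mult_ac)
  qed
qed

lemma exp_scale_le:
  fixes \<alpha> L :: real
  assumes "0 \<le> \<alpha>" "\<alpha> \<le> 1"
  shows "exp (\<alpha> * L) \<le> 1 + \<alpha> * (exp L - 1)"
proof -
  have "convex_on UNIV (exp :: real \<Rightarrow> real)" by (rule exp_convex)
  from convex_onD[OF this assms, of 0 L] show ?thesis by (simp add: algebra_simps)
qed

text \<open>
  If \<open>s > sqrt p\<close>, the prior is supported on vectors with only \<open>\<lfloor>sqrt p\<rfloor>\<close> nonzero coordinates,
  for which the sparse rate is already of order \<open>sqrt p\<close>.
\<close>

lemma risk_lower:
  fixes \<eta> :: real
  assumes \<eta>: "0 < \<eta>" "\<eta> < 1"
  obtains c0 where "c0 > 0"
    "\<And>p s \<gamma> v \<epsilon>. L2_set v {1..p} = sqrt (real p) \<Longrightarrow> 1 \<le> s \<Longrightarrow> 1 \<le> p \<Longrightarrow>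
      0 \<le> \<gamma> \<Longrightarrow> \<gamma> < 1 \<Longrightarrow> 0 \<le> \<epsilon> \<Longrightarrow> \<epsilon>\<^sup>2 \<le> c0 * ((1 - \<gamma>) * sq_rate p s) \<Longrightarrow> 1 - \<eta> \<le> risk p s \<gamma> v \<epsilon>"
proof -
  define c0 where "c0 = min (1 / 4) (ln (1 + \<eta>\<^sup>2) / 8)"
  have c0: "c0 > 0" "4 * c0 \<le> 1" "8 * c0 \<le> ln (1 + \<eta>\<^sup>2)"
    using \<eta> by (auto simp: c0_def intro!: ln_gt_zero)
  show ?thesis
  proof (rule that[OF c0(1)])
    fix p s \<gamma> v \<epsilon>
    assume L2: "L2_set v {1..p} = sqrt (real p)" and s: "1 \<le> s" and p: "1 \<le> p"
      and \<gamma>: "0 \<le> \<gamma>" "\<gamma> < 1" and \<epsilon>: "0 \<le> \<epsilon>" "\<epsilon>\<^sup>2 \<le> c0 * ((1 - \<gamma>) * sq_rate p s)"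
    define s0 where "s0 = (if real s \<le> sqrt p then s else nat \<lfloor>sqrt p\<rfloor>)"
    define l where "l = ln (1 + p / (real s0)\<^sup>2)"
    have sp1: "sqrt p \<ge> 1" using p by simp
    have s0: "1 \<le> s0" "s0 \<le> s" "real s0 \<le> sqrt p"
      using s sp1 by (auto simp: s0_def le_nat_iff nat_le_iff floor_le_iff of_nat_floor)
    have s0sq: "(real s0)\<^sup>2 \<le> p"
      using power_mono[OF s0(3), of 2] by simp
    then have "s0\<^sup>2 \<le> p" by (metis of_nat_le_iff of_nat_power)
    then have s0p: "s0 \<le> p" using self_le_power[of s0 2] s0(1) by simp
    have ps: "p / (real s0)\<^sup>2 \<ge> 1" using s0sq s0(1) by (simp add: field_simps)
    have l: "l \<ge> 1 / 2"
    proof -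
      have "ln 2 \<le> l" unfolding l_def using ps by (subst ln_le_cancel_iff) auto
      then show ?thesis using ln2_ge_two_thirds by simp
    qed
    have rate: "sq_rate p s \<le> 4 * s0 * l"
    proof (cases "real s \<le> sqrt p")
      case True
      then have "sq_rate p s = s0 * l" by (simp add: sq_rate_def s0_def l_def)
      moreover have "0 \<le> s0 * l" using l by simp
      ultimately show ?thesis by (simp add: mult.commute)
    next
      case False
      have "sqrt p \<le> real s0 + 1" using False sp1 by (simp add: s0_def)
      also have "\<dots> \<le> 2 * real s0" using s0(1) by simp
      also have "\<dots> \<le> 4 * s0 * l" using mult_left_mono[OF l, of "4 * real s0"] by simp
      finally show ?thesis using False by (simp add: sq_rate_def)
    qed
    define m where "m = p div s0"
    have m: "1 \<le> m" "s0 * m \<le> p"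
      using s0p s0(1) by (auto simp: m_def div_greater_zero_iff Suc_le_eq)
    have m2: "p \<le> 2 * (s0 * m)"
    proof -
      have "p mod s0 < s0" using s0(1) by simp
      moreover have "s0 * m + p mod s0 = p" by (simp add: m_def)
      moreover have "s0 \<le> s0 * m" using m(1) by simp
      ultimately show ?thesis by linarith
    qed
    have "\<epsilon>\<^sup>2 / (s0 * (1 - \<gamma>)) \<le> (4 * c0) * l"
    proof -
      have "\<epsilon>\<^sup>2 \<le> c0 * ((1 - \<gamma>) * (4 * s0 * l))"
        using \<epsilon>(2) rate c0(1) \<gamma> by (meson mult_left_mono order_trans less_imp_le diff_ge_0_iff_ge)
      then show ?thesis using s0(1) \<gamma> by (simp add: divide_le_eq mult_ac)
    qed
    then have "exp (\<epsilon>\<^sup>2 / (s0 * (1 - \<gamma>))) \<le> exp ((4 * c0) * l)" by simp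
    also have "\<dots> \<le> 1 + (4 * c0) * (exp l - 1)" using c0 by (intro exp_scale_le) auto
    also have "exp l = 1 + p / (real s0)\<^sup>2" unfolding l_def using ps by (subst exp_ln) auto
    finally have e: "exp (\<epsilon>\<^sup>2 / (s0 * (1 - \<gamma>))) - 1 \<le> 4 * c0 * p / (real s0)\<^sup>2" by simp
    have "s0 * (exp (\<epsilon>\<^sup>2 / (s0 * (1 - \<gamma>))) - 1) / m \<le> s0 * (4 * c0 * p / (real s0)\<^sup>2) / m"
      using e by (intro divide_right_mono mult_left_mono) auto
    also have "\<dots> = 4 * c0 * (p / (s0 * m))"
      using s0(1) m(1) by (simp add: field_simps power2_eq_square)
    also have "\<dots> \<le> 4 * c0 * 2"
    proof (intro mult_left_mono)
      have "real p \<le> 2 * (real s0 * real m)" using m2 by (metis of_nat_le_iff of_nat_mult of_nat_numeral)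
      then show "real p / real (s0 * m) \<le> 2" using s0(1) m(1) by (simp add: divide_le_eq)
    qed (use c0 in auto)
    also have "\<dots> \<le> ln (1 + \<eta>\<^sup>2)" using c0 by simp
    finally have "exp (s0 * (exp (\<epsilon>\<^sup>2 / (s0 * (1 - \<gamma>))) - 1) / m) \<le> exp (ln (1 + \<eta>\<^sup>2))"
      by (simp only: exp_le_cancel_iff)
    also have "exp (ln (1 + \<eta>\<^sup>2)) = 1 + \<eta>\<^sup>2" by (subst exp_ln) (auto intro: add_pos_nonneg)
    finally show "1 - \<eta> \<le> risk p s \<gamma> v \<epsilon>"
      by (intro risk_block_lower[OF L2 \<gamma> p s0(1,2) m \<eta>(1) \<epsilon>(1)])
  qed
qed

section \<open>The separation rate\<close>

theorem theorem9:
  "separation_rate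
     {(p, s, \<gamma>, v). v \<in> space (Rp p) \<and> L2_set v {1..p} = sqrt (real p) \<and>
        1 \<le> s \<and> s \<le> omega p v \<and> 0 \<le> \<gamma> \<and> \<gamma> \<le> 1}
     (\<lambda>p s \<gamma> v. sqrt (
        if real (omega p v) \<ge> sqrt (real p) then
          (if real s \<le> sqrt (real p)
           then (1 - \<gamma>) * real s * ln (1 + real p / (real s)\<^sup>2)
           else (1 - \<gamma>) * sqrt (real p))
        else (1 - \<gamma>) * real s * ln (1 + real p / (real s)\<^sup>2)))"
  (is "separation_rate ?D ?\<psi>")
proof -
  have \<psi>: "?\<psi> p s \<gamma> v = sqrt ((1 - \<gamma>) * sq_rate p s)" if "(p, s, \<gamma>, v) \<in> ?D" for p s \<gamma> v
    using that by (auto simp: sq_rate_def mult.assoc)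
  have nz: "\<gamma> < 1 \<and> (?\<psi> p s \<gamma> v)\<^sup>2 = (1 - \<gamma>) * sq_rate p s \<and> 0 < ?\<psi> p s \<gamma> v"
    if D: "(p, s, \<gamma>, v) \<in> ?D" and "?\<psi> p s \<gamma> v \<noteq> 0" for p s \<gamma> v
  proof -
    have "1 \<le> p" "1 \<le> s" "\<gamma> \<le> 1" using D omega_bound(1)[of s p v] by auto
    then have R: "0 < sq_rate p s" by (intro sq_rate_pos)
    have "\<gamma> \<noteq> 1" using that by (auto simp: \<psi>[OF D])
    with \<open>\<gamma> \<le> 1\<close> R show ?thesis unfolding \<psi>[OF D] by simp
  qed
  show ?thesis
    unfolding separation_rate_def
  proof (intro conjI ballI)
    fix \<eta> :: real assume "\<eta> \<in> {0<..<1}"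
    then have \<eta>: "0 < \<eta>" "\<eta> < 1" by auto
    obtain C where C: "C > 0" "\<And>p s \<gamma> v \<epsilon>. L2_set v {1..p} = sqrt (real p) \<Longrightarrow> 1 \<le> s \<Longrightarrow> s \<le> omega p v \<Longrightarrow>
      0 \<le> \<gamma> \<Longrightarrow> \<gamma> < 1 \<Longrightarrow> 0 \<le> \<epsilon> \<Longrightarrow> C * ((1 - \<gamma>) * sq_rate p s) \<le> \<epsilon>\<^sup>2 \<Longrightarrow> risk p s \<gamma> v \<epsilon> \<le> \<eta>"
      using risk_upper[OF \<eta>] by blast
    have "risk p s \<gamma> v (c * ?\<psi> p s \<gamma> v) \<le> \<eta>"
      if D: "(p, s, \<gamma>, v) \<in> ?D" and 0: "?\<psi> p s \<gamma> v \<noteq> 0" and c: "c > sqrt C" for p s \<gamma> v c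
    proof (rule C(2))
      note n = nz[OF D 0]
      have c0: "c > 0" using c C(1) by (meson less_trans real_sqrt_gt_zero)
      have "C \<le> c\<^sup>2" using c C(1) by (metis less_imp_le real_sqrt_le_iff real_sqrt_abs abs_of_pos c0)
      then show "C * ((1 - \<gamma>) * sq_rate p s) \<le> (c * ?\<psi> p s \<gamma> v)\<^sup>2"
        unfolding power_mult_distrib using n by (metis mult_right_mono zero_le_power2)
      show "0 \<le> c * ?\<psi> p s \<gamma> v" using c0 n by (intro mult_nonneg_nonneg less_imp_le) auto
      show "\<gamma> < 1" using n by blast
    qed (use D in auto)
    then show "\<exists>C\<^sub>\<eta>>0. \<forall>(p, s, \<gamma>, v)\<in>?D. ?\<psi> p s \<gamma> v \<noteq> 0 \<longrightarrow>
        (\<forall>C>C\<^sub>\<eta>. risk p s \<gamma> v (C * ?\<psi> p s \<gamma> v) \<le> \<eta>)"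
      using C(1) by (intro exI[of _ "sqrt C"]) auto
    obtain c0 where c0: "c0 > 0"
    "\<And>p s \<gamma> v \<epsilon>. L2_set v {1..p} = sqrt (real p) \<Longrightarrow> 1 \<le> s \<Longrightarrow> 1 \<le> p \<Longrightarrow>
      0 \<le> \<gamma> \<Longrightarrow> \<gamma> < 1 \<Longrightarrow> 0 \<le> \<epsilon> \<Longrightarrow> \<epsilon>\<^sup>2 \<le> c0 * ((1 - \<gamma>) * sq_rate p s) \<Longrightarrow> 1 - \<eta> \<le> risk p s \<gamma> v \<epsilon>"
      using risk_lower[OF \<eta>] by blast
    have "1 - \<eta> \<le> risk p s \<gamma> v (c * ?\<psi> p s \<gamma> v)"
      if D: "(p, s, \<gamma>, v) \<in> ?D" and 0: "?\<psi> p s \<gamma> v \<noteq> 0" and c: "0 < c" "c < sqrt c0" for p s \<gamma> v c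
    proof (rule c0(2))
      note n = nz[OF D 0]
      have "c\<^sup>2 \<le> (sqrt c0)\<^sup>2" using c by (intro power_mono) auto
      then have "c\<^sup>2 \<le> c0" using c0(1) by simp
      then show "(c * ?\<psi> p s \<gamma> v)\<^sup>2 \<le> c0 * ((1 - \<gamma>) * sq_rate p s)"
        unfolding power_mult_distrib using n by (metis mult_right_mono zero_le_power2)
      show "0 \<le> c * ?\<psi> p s \<gamma> v" using c n by (intro mult_nonneg_nonneg less_imp_le) auto
      show "\<gamma> < 1" using n by blast
      show "1 \<le> p" using D omega_bound(1)[of s p v] by auto
    qed (use D in auto)
    then show "\<exists>c\<^sub>\<eta>>0. \<forall>(p, s, \<gamma>, v)\<in>?D. ?\<psi> p s \<gamma> v \<noteq> 0 \<longrightarrow>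
        (\<forall>c. 0 < c \<and> c < c\<^sub>\<eta> \<longrightarrow> risk p s \<gamma> v (c * ?\<psi> p s \<gamma> v) \<ge> 1 - \<eta>)"
      using c0(1) by (intro exI[of _ "sqrt c0"]) auto
  next
    fix x assume "x \<in> ?D"
    moreover obtain p s \<gamma> v where x: "x = (p, s, \<gamma>, v)" by (cases x)
    ultimately have D: "(p, s, \<gamma>, v) \<in> ?D" by simp
    have "risk p s \<gamma> v \<epsilon> = 0" if 0: "?\<psi> p s \<gamma> v = 0" and \<epsilon>: "\<epsilon> > 0" for \<epsilon>
    proof -
      have "1 \<le> p" "1 \<le> s" using D omega_bound(1)[of s p v] by auto
      then have "0 < sq_rate p s" by (intro sq_rate_pos)
      then have "\<gamma> = 1" using 0 unfolding \<psi>[OF D] by simp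
      then show ?thesis using D \<epsilon> risk_degenerate[of v p s \<epsilon>] by auto
    qed
    then show "case x of (p, s, \<gamma>, v) \<Rightarrow> ?\<psi> p s \<gamma> v = 0 \<longrightarrow> (\<forall>\<epsilon>>0. risk p s \<gamma> v \<epsilon> = 0)"
      unfolding x by auto
  qed
qed

end
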